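(* For any $\lambda>0$ and any $\delta\in(0,1)$, with probability at least $1-\delta$, $$\Big\|\frac{\hat\alpha^{\rm MLE}}{\hat\sigma_{\rm MLE}}-\frac{\alpha^*}{\sigma^*}\Big\|_\infty\le\Big\|\frac{\hat\alpha^{\rm MLE}}{\hat\sigma_{\rm MLE}}-\frac{\alpha^*}{\sigma^*}\Big\|_2\le\frac{\sqrt{\frac{R_D+2\sqrt{-R_D\log\delta}-2\log\delta}{\omega^2K}}+\sqrt{\frac{R_D+2\sqrt{-R_D\log\delta}-2\log\delta}{\omega^2K}+\lambda\big(\bar c\sqrt{N-1}\big)^2}}{\sqrt{\lambda_{\min}(\Sigma_D+\lambda\mathbf{I})}},$$ where $\lambda_{\min}(\Sigma_D+\lambda\mathbf{I})$ is the minimum eigenvalue of $\Sigma_D+\lambda\mathbf{I}$, $\Sigma_D=\frac1KP^\top P\in\mathbb{R}^{(N-1)\times(N-1)}$, $R_D=\mathrm{rank}(\Sigma_D)$ and $\omega=\frac{1}{2+2\exp(2\bar c)}$.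
   Context: Fix constants $\bar b>0$, $L>0$, $\bar c>0$. $\mathcal{U}_c$ is the set of all functions $u:[0,\bar b]\to\mathbb{R}$ that are monotonically increasing (in the weak sense, i.e. nondecreasing), concave, Lipschitz continuous with modulus at most $L$, and satisfy $u(0)=0$, $u(\bar b)=1$. Data and model: $(W_k,Y_k)$, $k=1,\dots,K$, are given (non-random) pairs of lotteries, each lottery having finite support in $[0,\bar b]$. There are a true utility function $u^*\in\mathcal{U}_c$ and a true scale parameter $\sigma^*\ge1/\bar c$ such that the response is $Z_k=1$ if $\mathbb{E}[u^*(W_k)]+\varepsilon_{1k}\ge\mathbb{E}[u^*(Y_k)]+\varepsilon_{2k}$ and $Z_k=-1$ otherwise, where all $\varepsilon_{1k},\varepsilon_{2k}$ are i.i.d. $\mathrm{Gumbel}(0,\sigma^* )$ (CDF $e^{-e^{-x/\sigma^*}}$). Thus the $Z_k$ are independent with $\mathbb{P}(Z_k=1)=1/\big(1+\exp(-(\mathbb{E}[u^*(W_k)]-\mathbb{E}[u^*(Y_k)])/\sigma^* )\big)$; probability refers to the randomness of $(Z_1,\dots,Z_K)$. Let $\{y_1<\dots<y_N\}$ be the ordered list of all points of $\{0,\bar b\}\cup\bigcup_k \mathrm{supp}(W_k)\cup\bigcup_k\mathrm{supp}(Y_k)$ ($y_1=0$, $y_N=\bar b$), and $\alpha^*=(u^*(y_1),\dots,u^*(y_N))^\top$. Put $p^k_j=\mathbb{P}[W_k=y_j]-\mathbb{P}[Y_k=y_j]$, $p^k_{2:N}=(p^k_2,\dots,p^k_N)^\top$,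 and let $P\in\mathbb{R}^{K\times(N-1)}$ have $k$-th row $(p^k_{2:N})^\top$. MLE: let $(\bar\alpha^*,\bar\beta^*,\gamma^* )$ be an optimal solution of: maximize $-\sum_{k}\log\big[1+\exp\big(\sum_{j=1}^N -Z_kp^k_j\bar\alpha_j\big)\big]$ over $\bar\alpha\in\mathbb{R}^N$, $\bar\beta\in\mathbb{R}^{N-1}$, $\gamma\in[0,\bar c]$ subject to $\bar\beta_j=(\bar\alpha_{j+1}-\bar\alpha_j)/(y_{j+1}-y_j)$ ($1\le j\le N-1$), $\bar\beta_{j+1}\le\bar\beta_j$ ($1\le j\le N-2$), $\bar\beta_1\le L\gamma$, $\bar\beta_{N-1}\ge0$, $\bar\alpha_1=0$, $\bar\alpha_N=\gamma$. Then $\hat\alpha^{\rm MLE}=\bar\alpha^*/\gamma^*$ and $\hat\sigma_{\rm MLE}=1/\gamma^*$, so that $\hat\alpha^{\rm MLE}/\hat\sigma_{\rm MLE}=\bar\alpha^*$; if $\gamma^*=0$ (where $\hat\sigma_{\rm MLE}=+\infty$ and $\bar\alpha^*=0$), the ratio is read as $\bar\alpha^*=0$. *)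

theory Defs
  imports "HOL-Probability.Probability" "Jordan_Normal_Form.DL_Rank" "Jordan_Normal_Form.Char_Poly"
begin

text \<open>Utility functions on \<open>[0, b]\<close> are functions \<open>real \<Rightarrow> real\<close> of which only the values on
  \<open>{0..b}\<close> matter.\<close>

definition concave_utilities :: "real \<Rightarrow> real \<Rightarrow> (real \<Rightarrow> real) set" where
  "concave_utilities b L =
     {u. mono_on {0..b} u \<and> concave_on {0..b} u \<and> lipschitz_on L {0..b} u \<and> u 0 = 0 \<and> u b = 1}"

definition lottery_on :: "real \<Rightarrow> real pmf \<Rightarrow> bool" where
  "lottery_on b W \<longleftrightarrow> finite (set_pmf W) \<and> set_pmf W \<subseteq> {0..b}"

definition expected_utility :: "(real \<Rightarrow> real) \<Rightarrow> real pmf \<Rightarrow> real" where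
  "expected_utility u W = measure_pmf.expectation W u"

definition gumbel_cdf :: "real \<Rightarrow> real \<Rightarrow> real" where
  "gumbel_cdf s x = exp (- exp (- (x / s)))"

text \<open>Questions are indexed by \<open>k \<in> {1..K}\<close> and grid points by \<open>j \<in> {1..N}\<close>; vectors in
  \<open>\<real>\<^sup>N\<close> and \<open>\<real>\<^sup>N\<^sup>-\<^sup>1\<close> are functions on \<open>nat\<close> whose values outside these ranges are irrelevant.\<close>

definition prob_diff ::
    "(nat \<Rightarrow> real pmf) \<Rightarrow> (nat \<Rightarrow> real pmf) \<Rightarrow> (nat \<Rightarrow> real) \<Rightarrow> nat \<Rightarrow> nat \<Rightarrow> real" where
  "prob_diff W Y y k j = pmf (W k) (y j) - pmf (Y k) (y j)"

definition log_likelihood ::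
    "nat \<Rightarrow> nat \<Rightarrow> (nat \<Rightarrow> nat \<Rightarrow> real) \<Rightarrow> (nat \<Rightarrow> real) \<Rightarrow> (nat \<Rightarrow> real) \<Rightarrow> real" where
  "log_likelihood K N p z a =
     - (\<Sum>k = 1..K. ln (1 + exp (\<Sum>j = 1..N. - z k * p k j * a j)))"

definition mle_feasible ::
    "real \<Rightarrow> real \<Rightarrow> nat \<Rightarrow> (nat \<Rightarrow> real) \<Rightarrow> (nat \<Rightarrow> real) \<Rightarrow> (nat \<Rightarrow> real) \<Rightarrow> real \<Rightarrow> bool" where
  "mle_feasible c L N y a \<beta> \<gamma> \<longleftrightarrow>
     0 \<le> \<gamma> \<and> \<gamma> \<le> c \<and>
     (\<forall>j\<in>{1..N-1}. \<beta> j = (a (j+1) - a j) / (y (j+1) - y j)) \<and>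
     (\<forall>j\<in>{1..N-2}. \<beta> (j+1) \<le> \<beta> j) \<and>
     \<beta> 1 \<le> L * \<gamma> \<and> 0 \<le> \<beta> (N-1) \<and> a 1 = 0 \<and> a N = \<gamma>"

definition mle_optimal ::
    "real \<Rightarrow> real \<Rightarrow> nat \<Rightarrow> nat \<Rightarrow> (nat \<Rightarrow> real) \<Rightarrow> (nat \<Rightarrow> nat \<Rightarrow> real) \<Rightarrow> (nat \<Rightarrow> real) \<Rightarrow>
     (nat \<Rightarrow> real) \<Rightarrow> (nat \<Rightarrow> real) \<Rightarrow> real \<Rightarrow> bool" where
  "mle_optimal c L K N y p z a \<beta> \<gamma> \<longleftrightarrow>
     mle_feasible c L N y a \<beta> \<gamma> \<and>
     (\<forall>a' \<beta>' \<gamma>'. mle_feasible c L N y a' \<beta>' \<gamma>' \<longrightarrow>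
        log_likelihood K N p z a' \<le> log_likelihood K N p z a)"

definition alpha_MLE :: "(nat \<Rightarrow> real) \<Rightarrow> real \<Rightarrow> nat \<Rightarrow> real" where
  "alpha_MLE a \<gamma> j = a j / \<gamma>"

definition sigma_MLE :: "real \<Rightarrow> real" where
  "sigma_MLE \<gamma> = 1 / \<gamma>"

text \<open>For \<open>\<gamma> = 0\<close> the scale estimate is \<open>+\<infinity>\<close>, and the ratio is by convention the vector \<open>a\<close>
  itself.\<close>

definition MLE_ratio :: "(nat \<Rightarrow> real) \<Rightarrow> real \<Rightarrow> nat \<Rightarrow> real" where
  "MLE_ratio a \<gamma> j = (if \<gamma> = 0 then a j else alpha_MLE a \<gamma> j / sigma_MLE \<gamma>)"

definition Linf_norm :: "nat \<Rightarrow> (nat \<Rightarrow> real) \<Rightarrow> real" where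
  "Linf_norm N v = Max ((\<lambda>j. \<bar>v j\<bar>) ` {1..N})"

definition L2_norm :: "nat \<Rightarrow> (nat \<Rightarrow> real) \<Rightarrow> real" where
  "L2_norm N v = L2_set v {1..N}"

text \<open>Matrices are indexed from 0, and the first grid point is dropped: entry \<open>(i, l)\<close> is
  question \<open>i + 1\<close> at grid point \<open>l + 2\<close>.\<close>

definition design_matrix :: "nat \<Rightarrow> nat \<Rightarrow> (nat \<Rightarrow> nat \<Rightarrow> real) \<Rightarrow> real mat" where
  "design_matrix K N p = Matrix.mat K (N - 1) (\<lambda>(i, l). p (i + 1) (l + 2))"

definition Sigma_D :: "nat \<Rightarrow> nat \<Rightarrow> (nat \<Rightarrow> nat \<Rightarrow> real) \<Rightarrow> real mat" where
  "Sigma_D K N p =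
     (1 / real K) \<cdot>\<^sub>m (transpose_mat (design_matrix K N p) * design_matrix K N p)"

definition mat_rank :: "real mat \<Rightarrow> nat" where
  "mat_rank A = vec_space.rank (dim_row A) A"

definition min_eigenvalue :: "real mat \<Rightarrow> real" where
  "min_eigenvalue A = Min {\<mu>. eigenvalue A \<mu>}"

definition omega :: "real \<Rightarrow> real" where
  "omega c = 1 / (2 + 2 * exp (2 * c))"

definition sq_radius :: "real \<Rightarrow> nat \<Rightarrow> nat \<Rightarrow> real \<Rightarrow> real" where
  "sq_radius c K R \<delta> =
     (real R + 2 * sqrt (- (real R) * ln \<delta>) - 2 * ln \<delta>) / ((omega c)\<^sup>2 * real K)"

end

theory Submission
  imports Defs
begin

text \<open>Let \<open>d\<close> be the difference between the maximum likelihood estimate and the true vector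
  \<open>\<alpha>\<^sup>* / \<sigma>\<^sup>*\<close>, which is itself feasible. The logistic loss is strongly convex with modulus \<open>\<omega>\<close> on
  \<open>[-c, c]\<close>, so optimality gives \<open>\<omega>/2 |P d|\<^sup>2 \<le> V \<bullet> P d\<close> for the score \<open>V\<close> at the true vector.
  Only the projection of \<open>V\<close> to the column space of \<open>P\<close> enters, whose dimension is the rank of
  \<open>\<Sigma>\<close>, and \<open>V\<close> has independent centered entries bounded by 1 because a difference of Gumbel
  variables is logistic. The squared length of this projection has the tail of a chi-square
  variable: writing \<open>exp (h s\<^sup>2 / 2)\<close> as a Gaussian average of \<open>exp (sqrt h g s)\<close> reduces its
  moment generating function to the subgaussian bound for linear forms in \<open>V\<close>. Finally
  \<open>|d\<^sub>j| \<le> c\<close> bounds the ridge term \<open>\<lambda> |d|\<^sup>2\<close>.\<close>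


text \<open>The lotteries are not random, so one orthonormal family for the column space of P serves
  every response pattern. Once the projected score is small, the rest is deterministic and holds for
  all optimal solutions at once. Two obstacles shape the proof. The rank in the claim is that of P^T
  P, so relations between columns of the Gram matrix must be carried over to the columns of P. And
  the coordinates of the projected score need not be independent although the entries of V are, so
  the moment generating function of their sum of squares does not factor; the Gaussian average
  replaces squares by linear forms, where independence can be used. Constants: entries in [-1, 1]
  have variance proxy 1 by Hoeffding's lemma, so the threshold R + 2 sqrt (R t) + 2 t with t = - ln
  \<delta> appears without a further factor. Strong convexity gives |P d|^2 / K \<le> 4 \<rho> with
  \<rho> = \<open>sq_radius\<close>, and 4 \<rho> + B \<le> (sqrt \<rho> + sqrt (\<rho> + B))^2
  explains the two roots in the claim. A positive \<lambda> keeps the smallest eigenvalue positive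
  when the questions do not determine all grid values.\<close>

section \<open>Orthonormal families and the rank of a Gram matrix\<close>

definition sum_prod :: "'i set \<Rightarrow> ('i \<Rightarrow> real) \<Rightarrow> ('i \<Rightarrow> real) \<Rightarrow> real" where
  "sum_prod I x y = (\<Sum>k\<in>I. x k * y k)"

definition orthonormal :: "'i set \<Rightarrow> nat \<Rightarrow> (nat \<Rightarrow> 'i \<Rightarrow> real) \<Rightarrow> bool" where
  "orthonormal I r q \<longleftrightarrow> (\<forall>i<r. \<forall>j<r. sum_prod I (q i) (q j) = (if i = j then 1 else 0))"

text \<open>Membership in the span of \<open>q\<close>, written with the coefficients that
  orthonormality forces, so that no existential choice of coefficients has to be carried
  along.\<close>

definition expands_in :: "'i set \<Rightarrow> nat \<Rightarrow> (nat \<Rightarrow> 'i \<Rightarrow> real) \<Rightarrow> ('i \<Rightarrow> real) \<Rightarrow> bool" where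
  "expands_in I r q x \<longleftrightarrow> (\<forall>k\<in>I. x k = (\<Sum>i<r. sum_prod I (q i) x * q i k))"

lemma sum_prod_cong:
  "(\<And>k. k \<in> I \<Longrightarrow> x k = x' k) \<Longrightarrow> (\<And>k. k \<in> I \<Longrightarrow> y k = y' k) \<Longrightarrow> sum_prod I x y = sum_prod I x' y'"
  unfolding sum_prod_def by (intro sum.cong) auto

lemma sum_prod_commute: "sum_prod I x y = sum_prod I y x"
  unfolding sum_prod_def by (simp add: mult.commute)

lemma sum_prod_add_left: "sum_prod I (\<lambda>k. x k + y k) z = sum_prod I x z + sum_prod I y z"
  unfolding sum_prod_def by (simp add: algebra_simps sum.distrib)

lemma sum_prod_diff_right: "sum_prod I z (\<lambda>k. x k - y k) = sum_prod I z x - sum_prod I z y"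
  unfolding sum_prod_def by (simp add: algebra_simps sum_subtractf)

lemma sum_prod_scale_right: "sum_prod I z (\<lambda>k. c * x k) = c * sum_prod I z x"
  unfolding sum_prod_def by (simp add: algebra_simps sum_distrib_left)

lemma sum_prod_scale_left: "sum_prod I (\<lambda>k. c * x k) z = c * sum_prod I x z"
  unfolding sum_prod_def by (simp add: algebra_simps sum_distrib_left)

lemma sum_prod_sum_right: "sum_prod I z (\<lambda>k. \<Sum>i\<in>J. c i * x i k) = (\<Sum>i\<in>J. c i * sum_prod I z (x i))"
proof -
  have "sum_prod I z (\<lambda>k. \<Sum>i\<in>J. c i * x i k) = (\<Sum>k\<in>I. \<Sum>i\<in>J. c i * (z k * x i k))"
    unfolding sum_prod_def by (intro sum.cong) (auto simp: sum_distrib_left mult_ac)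
  also have "\<dots> = (\<Sum>i\<in>J. \<Sum>k\<in>I. c i * (z k * x i k))"
    by (rule sum.swap)
  finally show ?thesis
    unfolding sum_prod_def by (simp add: sum_distrib_left)
qed

lemma sum_prod_self_nonneg: "0 \<le> sum_prod I x x"
  unfolding sum_prod_def by (simp add: sum_nonneg)

lemma sum_prod_self_eq_0: "finite I \<Longrightarrow> sum_prod I x x = 0 \<longleftrightarrow> (\<forall>k\<in>I. x k = 0)"
  unfolding sum_prod_def by (subst sum_nonneg_eq_0_iff) auto

lemma expands_in_sum:
  assumes "\<And>j. j \<in> J \<Longrightarrow> expands_in I r q (v j)"
  shows "expands_in I r q (\<lambda>k. \<Sum>j\<in>J. c j * v j k)"
  unfolding expands_in_def
proof
  fix k assume k: "k \<in> I"
  have "(\<Sum>j\<in>J. c j * v j k) = (\<Sum>j\<in>J. \<Sum>i<r. c j * (sum_prod I (q i) (v j) * q i k))"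
    using assms k unfolding expands_in_def sum_distrib_left[symmetric]
    by (intro sum.cong arg_cong2[of _ _ _ _ "(*)"]) blast+
  also have "\<dots> = (\<Sum>i<r. \<Sum>j\<in>J. c j * (sum_prod I (q i) (v j) * q i k))"
    by (rule sum.swap)
  also have "\<dots> = (\<Sum>i<r. sum_prod I (q i) (\<lambda>k. \<Sum>j\<in>J. c j * v j k) * q i k)"
    unfolding sum_prod_sum_right by (simp add: sum_distrib_left sum_distrib_right mult_ac)
  finally show "(\<Sum>j\<in>J. c j * v j k) = \<dots>" .
qed

lemma expands_in_cong:
  "expands_in I r q x \<Longrightarrow> (\<And>k. k \<in> I \<Longrightarrow> x k = y k) \<Longrightarrow> expands_in I r q y"
  unfolding expands_in_def using sum_prod_cong[of I "q _" "q _" x y] by simp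

text \<open>Dependent vectors are allowed: a vector whose residual vanishes contributes no new
  direction, so \<open>r\<close> may fall short of \<open>m\<close>.\<close>

lemma gram_schmidt:
  fixes v :: "nat \<Rightarrow> 'i \<Rightarrow> real"
  assumes I: "finite I"
  shows "\<exists>r q. r \<le> m \<and> orthonormal I r q \<and> (\<forall>l<m. expands_in I r q (v l))"
proof (induction m)
  case 0
  show ?case by (intro exI[of _ 0]) (auto simp: orthonormal_def)
next
  case (Suc m)
  then obtain r q where r: "r \<le> m" and q: "orthonormal I r q"
    and exp: "\<And>l. l < m \<Longrightarrow> expands_in I r q (v l)" by blast
  define x where "x = v m"
  define w where "w = (\<lambda>k. x k - (\<Sum>i<r. sum_prod I (q i) x * q i k))"
  have w_orth: "sum_prod I (q j) w = 0" if "j < r" for j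
  proof -
    have "sum_prod I (q j) w = sum_prod I (q j) x - sum_prod I (q j) (\<lambda>k. \<Sum>i<r. sum_prod I (q i) x * q i k)"
      unfolding w_def by (rule sum_prod_diff_right)
    also have "\<dots> = sum_prod I (q j) x - (\<Sum>i<r. sum_prod I (q i) x * (if j = i then 1 else 0))"
      unfolding sum_prod_sum_right using q that by (simp add: orthonormal_def)
    also have "(\<Sum>i<r. sum_prod I (q i) x * (if j = i then 1 else 0)) = sum_prod I (q j) x"
      using that sum.delta'[of "{..<r}" j "\<lambda>i. sum_prod I (q i) x"] by (simp add: if_distrib cong: if_cong)
    finally show ?thesis by simp
  qed
  show ?case
  proof (cases "sum_prod I w w = 0")
    case True
    then have "expands_in I r q x"
      unfolding sum_prod_self_eq_0[OF I] by (simp add: expands_in_def w_def)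
    then have "\<forall>l<Suc m. expands_in I r q (v l)"
      using exp x_def by (auto simp: less_Suc_eq)
    then show ?thesis using r q by (intro exI[of _ r] exI[of _ q]) auto
  next
    case False
    note w_ne = False
    define s where "s = sqrt (sum_prod I w w)"
    have s: "s > 0" "s * s = sum_prod I w w"
      using False sum_prod_self_nonneg[of I w] by (auto simp: s_def)
    define q' where "q' = q(r := (\<lambda>k. (1 / s) * w k))"
    have q'_less: "q' i = q i" if "i < r" for i using that by (simp add: q'_def)
    have q'_r: "q' r = (\<lambda>k. (1 / s) * w k)" by (simp add: q'_def)
    have w_orth': "sum_prod I w (q j) = 0" if "j < r" for j
      using w_orth[OF that] by (simp add: sum_prod_commute)
    have orth_r: "sum_prod I (q' r) (q' j) = 0" "sum_prod I (q' j) (q' r) = 0" if "j < r" for j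
      using w_orth'[OF that] sum_prod_commute[of I "q' j" "q' r"] unfolding q'_less[OF that] q'_r
      by (simp_all add: sum_prod_scale_left[of I "1 / s", simplified])
    have "sum_prod I (q' r) (q' r) = (1 / s) * ((1 / s) * sum_prod I w w)"
      unfolding q'_r sum_prod_scale_left sum_prod_scale_right ..
    then have norm_r: "sum_prod I (q' r) (q' r) = 1" using s False by simp
    have orth: "orthonormal I (Suc r) q'"
      unfolding orthonormal_def
    proof (intro allI impI)
      fix i j assume "i < Suc r" "j < Suc r"
      then consider "i < r" "j < r" | "i = r" "j < r" | "i < r" "j = r" | "i = r" "j = r" by linarith
      then show "sum_prod I (q' i) (q' j) = (if i = j then 1 else 0)"
        by cases (use q in \<open>auto simp: orth_r norm_r orthonormal_def\<close>, simp_all add: q'_less)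
    qed
    \<comment> \<open>The normalization by \<open>s\<close> occurs twice in the new term, once in
      the coefficient and once in the direction.\<close>
    have ext: "expands_in I (Suc r) q' z \<longleftrightarrow>
       (\<forall>k\<in>I. z k = (\<Sum>i<r. sum_prod I (q i) z * q i k) + sum_prod I w z / (s * s) * w k)" for z
      unfolding expands_in_def by (simp add: q'_less q'_r sum_prod_scale_left[of I "1 / s", simplified])
    have "expands_in I (Suc r) q' (v l)" if "l < Suc m" for l
    proof (cases "l = m")
      case True
      \<comment> \<open>As \<open>w\<close> is orthogonal to the part subtracted from
        \<open>x\<close>, its product with \<open>x\<close> is its own squared length; the new term
        of the expansion therefore returns exactly \<open>w\<close>.\<close>
      have "sum_prod I w w = sum_prod I w x - sum_prod I w (\<lambda>k. \<Sum>i<r. sum_prod I (q i) x * q i k)"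
        by (subst (2) w_def) (rule sum_prod_diff_right)
      also have "sum_prod I w (\<lambda>k. \<Sum>i<r. sum_prod I (q i) x * q i k) = 0"
        unfolding sum_prod_sum_right by (simp add: w_orth')
      finally have "sum_prod I w x = s * s" using s by simp
      moreover have "w k = x k - (\<Sum>i<r. sum_prod I (q i) x * q i k)" for k
        by (simp add: w_def)
      ultimately show ?thesis unfolding ext True x_def[symmetric] using s w_ne by simp
    next
      case False
      then have e: "expands_in I r q (v l)" using exp that by simp
      have "sum_prod I w (v l) = sum_prod I w (\<lambda>k. \<Sum>i<r. sum_prod I (q i) (v l) * q i k)"
        using e unfolding expands_in_def by (intro sum_prod_cong) auto
      also have "\<dots> = 0" unfolding sum_prod_sum_right by (simp add: w_orth')
      finally show ?thesis using e by (subst ext) (simp add: expands_in_def)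
    qed
    then show ?thesis using r orth by (intro exI[of _ "Suc r"] exI[of _ q']) auto
  qed
qed

text \<open>A maximal independent set of columns has as many members as the rank, and a column
  outside its span would enlarge it. Indices and entries are used so that the relations can be read
  off a Gram matrix.\<close>

lemma rank_spanning_columns:
  fixes A :: "real mat"
  assumes A: "A \<in> carrier_mat n m"
  obtains f :: "nat \<Rightarrow> nat" where
    "\<And>j. j < vec_space.rank n A \<Longrightarrow> f j < m"
    "\<And>l. l < m \<Longrightarrow> \<exists>c. \<forall>i<n. A $$ (i, l) = (\<Sum>j<vec_space.rank n A. c j * A $$ (i, f j))"
proof -
  interpret vec_space "TYPE(real)" n .
  have cols: "set (cols A) \<subseteq> carrier_vec n" using cols_dim[of A] A by auto
  obtain S where S: "maximal S (\<lambda>T. T \<subseteq> set (cols A) \<and> lin_indpt T)" and fS: "finite S"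
    using maximal_exists_superset[of "set (cols A)" "\<lambda>T. T \<subseteq> set (cols A) \<and> lin_indpt T" "{}"]
      by (auto simp: lin_dep_def)
  have rank: "rank A = card S" by (rule rank_card_indpt[OF A S])
  have Sc: "S \<subseteq> set (cols A)" and Si: "lin_indpt S" using S by (auto simp: maximal_def)
  have Sv: "S \<subseteq> carrier_vec n" using Sc cols by blast
  obtain g where g: "bij_betw g {..<card S} S"
    using ex_bij_betw_nat_finite[OF fS] by (auto simp: atLeast0LessThan)
  have "\<exists>i<m. col A i = g j" if "j < card S" for j
  proof -
    have "g j \<in> set (cols A)" using g that Sc by (auto simp: bij_betw_def)
    then show ?thesis using A by (auto simp: cols_def)
  qed
  then obtain f where f: "\<And>j. j < card S \<Longrightarrow> f j < m \<and> col A (f j) = g j" by metis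
  have "\<exists>c. \<forall>i<n. A $$ (i, l) = (\<Sum>j<card S. c j * A $$ (i, f j))" if l: "l < m" for l
  proof -
    have cl: "col A l \<in> set (cols A)" using A l by (auto simp: cols_def)
    have "col A l \<in> span S"
    proof (rule ccontr)
      assume ns: "col A l \<notin> span S"
      then have "col A l \<notin> S" using span_mem[OF Sv] by blast
      moreover have "lin_indpt (S \<union> {col A l})"
        using lin_dep_iff_in_span[OF Sv Si _ \<open>col A l \<notin> S\<close>] ns cl cols by blast
      ultimately show False using S Sc cl by (auto simp: maximal_def)
    qed
    then obtain a where a: "col A l = lincomb a S"
      using finite_span[OF fS Sv] by auto
    have "A $$ (i, l) = (\<Sum>j<card S. a (g j) * A $$ (i, f j))" if i: "i < n" for i
    proof -
      have col: "col A l' $ i = A $$ (i, l')" if "l' < m" for l'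
        using A i that by simp
      have "A $$ (i, l) = lincomb a S $ i" using col[OF l] a by simp
      also have "\<dots> = (\<Sum>x\<in>S. a x * x $ i)" by (rule lincomb_index[OF i Sv])
      also have "\<dots> = (\<Sum>j<card S. a (g j) * g j $ i)"
        using sum.reindex_bij_betw[OF g, of "\<lambda>x. a x * x $ i"] by simp
      also have "\<dots> = (\<Sum>j<card S. a (g j) * A $$ (i, f j))"
        using f col by (intro sum.cong refl) force
      finally show ?thesis .
    qed
    then show ?thesis by (intro exI[of _ "\<lambda>j. a (g j)"]) simp
  qed
  note span = this
  show ?thesis
  proof (rule that)
    show "f j < m" if "j < rank A" for j using f that by (simp add: rank)
    show "\<exists>c. \<forall>i<n. A $$ (i, l) = (\<Sum>j<rank A. c j * A $$ (i, f j))" if "l < m" for l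
      unfolding rank using that by (rule span)
  qed
qed

text \<open>A relation between columns of a Gram matrix is a relation between the vectors
  themselves: the residual \<open>w\<close> is orthogonal to every \<open>v i\<close>, and since it
  is a combination of these vectors it is orthogonal to itself. Hence the vectors selected by
  \<open>f\<close> already span all of them.\<close>

lemma gram_matrix_orthonormal:
  fixes v :: "nat \<Rightarrow> 'i \<Rightarrow> real"
  assumes I: "finite I" and A: "A \<in> carrier_mat n n" and s: "s \<noteq> 0"
    and gram: "\<And>i l. i < n \<Longrightarrow> l < n \<Longrightarrow> A $$ (i, l) = s * sum_prod I (v i) (v l)"
  obtains r q where "r \<le> vec_space.rank n A" "orthonormal I r q" "\<And>l. l < n \<Longrightarrow> expands_in I r q (v l)"
proof -
  let ?R = "vec_space.rank n A"
  obtain f where f: "\<And>j. j < ?R \<Longrightarrow> f j < n"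
    and span: "\<And>l. l < n \<Longrightarrow> \<exists>c. \<forall>i<n. A $$ (i, l) = (\<Sum>j<?R. c j * A $$ (i, f j))"
    using rank_spanning_columns[OF A] by blast
  obtain r q where r: "r \<le> ?R" and q: "orthonormal I r q"
    and exp: "\<And>j. j < ?R \<Longrightarrow> expands_in I r q (v (f j))"
    using gram_schmidt[OF I, of ?R "\<lambda>j. v (f j)"] by blast
  have "expands_in I r q (v l)" if l: "l < n" for l
  proof -
    obtain c where c: "\<And>i. i < n \<Longrightarrow> A $$ (i, l) = (\<Sum>j<?R. c j * A $$ (i, f j))"
      using span[OF l] by blast
    define w where "w = (\<lambda>k. v l k - (\<Sum>j<?R. c j * v (f j) k))"
    have vw: "sum_prod I (v i) w = 0" if i: "i < n" for i
    proof -
      have "s * sum_prod I (v i) w = s * sum_prod I (v i) (v l) - s * sum_prod I (v i) (\<lambda>k. \<Sum>j<?R. c j * v (f j) k)"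
        unfolding w_def sum_prod_diff_right by (simp add: algebra_simps)
      also have "s * sum_prod I (v i) (\<lambda>k. \<Sum>j<?R. c j * v (f j) k)
          = (\<Sum>j<?R. c j * (s * sum_prod I (v i) (v (f j))))"
        unfolding sum_prod_sum_right sum_distrib_left by (intro sum.cong) auto
      also have "\<dots> = (\<Sum>j<?R. c j * A $$ (i, f j))"
        using f i by (intro sum.cong) (auto simp: gram)
      finally show ?thesis using c[OF i] gram[OF i l] s by simp
    qed
    have "sum_prod I w w = sum_prod I w (v l) - sum_prod I w (\<lambda>k. \<Sum>j<?R. c j * v (f j) k)"
      by (subst (2) w_def) (rule sum_prod_diff_right)
    also have "\<dots> = sum_prod I (v l) w - (\<Sum>j<?R. c j * sum_prod I (v (f j)) w)"
      unfolding sum_prod_sum_right by (simp only: sum_prod_commute[of I w "v _"])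
    also have "\<dots> = 0"
      using vw f l by simp
    finally have "\<forall>k\<in>I. w k = 0" using sum_prod_self_eq_0[OF I] by blast
    then have w0: "(\<Sum>j<?R. c j * v (f j) k) = v l k" if "k \<in> I" for k
      using that by (simp add: w_def)
    have "expands_in I r q (\<lambda>k. \<Sum>j<?R. c j * v (f j) k)"
      using exp by (intro expands_in_sum) auto
    then show ?thesis using w0 by (rule expands_in_cong)
  qed
  then show ?thesis using r q that by blast
qed

section \<open>Gaussian and Gumbel integrals\<close>

text \<open>Read from right to left, this trades a square in an exponent for an average of linear
  exponents, to which a subgaussian bound applies.\<close>

lemma nn_integral_gaussian_exp:
  fixes z :: real
  shows "(\<integral>\<^sup>+g. ennreal (std_normal_density g * exp (g * z)) \<partial>lborel) = ennreal (exp (z\<^sup>2 / 2))"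
proof -
  \<comment> \<open>Completing the square: the linear tilt moves the mean of the normal density from
    0 to \<open>z\<close>.\<close>
  have "std_normal_density g * exp (g * z) = exp (z\<^sup>2 / 2) * normal_density z 1 g" for g
    unfolding normal_density_def
    by (simp add: exp_add[symmetric] power2_eq_square field_simps flip: exp_minus)
  then have "(\<integral>\<^sup>+g. ennreal (std_normal_density g * exp (g * z)) \<partial>lborel)
      = (\<integral>\<^sup>+g. ennreal (exp (z\<^sup>2 / 2)) * ennreal (normal_density z 1 g) \<partial>lborel)"
    by (intro nn_integral_cong) (simp add: ennreal_mult)
  also have "\<dots> = ennreal (exp (z\<^sup>2 / 2)) * (\<integral>\<^sup>+g. ennreal (normal_density z 1 g) \<partial>lborel)"
    by (rule nn_integral_cmult) simp
  also have "(\<integral>\<^sup>+g. ennreal (normal_density z 1 g) \<partial>lborel) = ennreal 1"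
    by (subst nn_integral_eq_integral) auto
  finally show ?thesis by simp
qed

text \<open>The moment generating function of a chi-square variable at \<open>h / 2\<close>. The
  quadratic tilt changes the variance to \<open>1 / (1 - h)\<close>, hence the condition on
  \<open>h\<close>.\<close>

lemma nn_integral_gaussian_exp_square:
  fixes h :: real
  assumes "h < 1"
  shows "(\<integral>\<^sup>+g. ennreal (std_normal_density g * exp (h * g\<^sup>2 / 2)) \<partial>lborel) = ennreal (1 / sqrt (1 - h))"
proof -
  let ?s = "1 / sqrt (1 - h)"
  have "std_normal_density g * exp (h * g\<^sup>2 / 2) = ?s * normal_density 0 ?s g" for g
  proof -
    have "exp (- g\<^sup>2 / 2) * exp (h * g\<^sup>2 / 2) = exp (- (1 - h) * g\<^sup>2 / 2)"
      by (simp add: exp_add[symmetric] field_simps)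
    also have "- (1 - h) * g\<^sup>2 / 2 = - g\<^sup>2 / (2 * ?s\<^sup>2)"
      using assms by (simp add: field_simps power_divide)
    finally have "exp (- g\<^sup>2 / 2) * exp (h * g\<^sup>2 / 2) = exp (- g\<^sup>2 / (2 * ?s\<^sup>2))" .
    moreover have "sqrt (2 * pi * ?s\<^sup>2) = sqrt (2 * pi) * ?s"
      using assms by (simp add: real_sqrt_mult real_sqrt_divide power_divide)
    ultimately show ?thesis
      unfolding normal_density_def using assms by (simp add: field_simps)
  qed
  then have "(\<integral>\<^sup>+g. ennreal (std_normal_density g * exp (h * g\<^sup>2 / 2)) \<partial>lborel)
      = (\<integral>\<^sup>+g. ennreal ?s * ennreal (normal_density 0 ?s g) \<partial>lborel)"
    using assms by (intro nn_integral_cong, subst ennreal_mult[symmetric]) auto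
  also have "\<dots> = ennreal ?s * (\<integral>\<^sup>+g. ennreal (normal_density 0 ?s g) \<partial>lborel)"
    by (rule nn_integral_cmult) simp
  also have "(\<integral>\<^sup>+g. ennreal (normal_density 0 ?s g) \<partial>lborel) = ennreal 1"
    using assms by (subst nn_integral_eq_integral) auto
  finally show ?thesis by simp
qed

definition gumbel_density :: "real \<Rightarrow> real \<Rightarrow> real" where
  "gumbel_density s x = exp (- (x / s)) * exp (- exp (- (x / s))) / s"

text \<open>The extra factor merges with the double exponential of the density and turns its
  coefficient 1 into \<open>1 + a\<close>, which leaves an explicit antiderivative. The case
  \<open>a = 0\<close> yields the distribution function; \<open>a = exp (- (d / s))\<close> yields
  the comparison of two noises.\<close>

lemma gumbel_power_integral:
  fixes s a x :: real
  assumes s: "s > 0" and a: "a \<ge> 0"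
  defines "f \<equiv> \<lambda>x. exp (- a * exp (- (x / s))) * gumbel_density s x"
    and "F \<equiv> \<lambda>x. exp (- (1 + a) * exp (- (x / s))) / (1 + a)"
  shows "(\<integral>\<^sup>+y\<in>{..x}. ennreal (f y) \<partial>lborel) = ennreal (F x)"
    and "(\<integral>\<^sup>+y. ennreal (f y) \<partial>lborel) = ennreal (1 / (1 + a))"
proof -
  have f_nonneg: "f y \<ge> 0" for y using s by (simp add: f_def gumbel_density_def)
  have f_meas: "f \<in> borel_measurable borel" unfolding f_def gumbel_density_def by measurable
  have deriv: "(F has_real_derivative f y) (at y)" for y
  proof -
    define E where "E = (\<lambda>y. exp (- (y / s)))"
    have E: "(E has_real_derivative - (E y / s)) (at y)"
      unfolding E_def using s by (auto intro!: derivative_eq_intros)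
    have "exp (- (1 + a) * E y) = exp (- a * E y) * exp (- E y)"
      by (simp add: exp_add[symmetric] algebra_simps)
    moreover have "((\<lambda>y. exp (- (1 + a) * E y)) has_real_derivative
        exp (- (1 + a) * E y) * (E y / s) * (1 + a)) (at y)"
      using E by (auto intro!: derivative_eq_intros) (simp add: algebra_simps add_divide_distrib diff_divide_distrib)
    from DERIV_cdivide[OF this, of "1 + a"]
    have "((\<lambda>y. exp (- (1 + a) * E y) / (1 + a)) has_real_derivative exp (- (1 + a) * E y) * (E y / s)) (at y)"
      using a by simp
    ultimately have "((\<lambda>y. exp (- (1 + a) * E y) / (1 + a)) has_real_derivative
        exp (- a * E y) * (E y * exp (- E y) / s)) (at y)"
      by (simp add: mult_ac)
    then show ?thesis unfolding F_def f_def gumbel_density_def E_def .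
  qed
  have bot: "(F \<longlongrightarrow> 0) at_bot"
  proof -
    have "filterlim (\<lambda>x. - (x / s)) at_top at_bot" using s by real_asymp
    then have "filterlim (\<lambda>x. exp (- (x / s))) at_top at_bot"
      using filterlim_compose[OF exp_at_top] by blast
    then have "filterlim (\<lambda>x. - (1 + a) * exp (- (x / s))) at_bot at_bot"
      using a by (intro filterlim_tendsto_neg_mult_at_bot[OF tendsto_const]) auto
    then have "((\<lambda>x. exp (- (1 + a) * exp (- (x / s)))) \<longlongrightarrow> 0) at_bot"
      using filterlim_compose[OF exp_at_bot] by blast
    from tendsto_divide[OF this tendsto_const[of "1 + a"]]
    show ?thesis unfolding F_def using a by simp
  qed
  have top: "(F \<longlongrightarrow> 1 / (1 + a)) at_top"
  proof -
    have "filterlim (\<lambda>x. - (x / s)) at_bot at_top" using s by real_asymp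
    then have "((\<lambda>x. exp (- (x / s))) \<longlongrightarrow> 0) at_top"
      using filterlim_compose[OF exp_at_bot] by blast
    note lim = this
    have "((\<lambda>x. exp (- (1 + a) * exp (- (x / s))) / (1 + a)) \<longlongrightarrow> exp (- (1 + a) * 0) / (1 + a)) at_top"
      using a by (intro tendsto_intros lim) simp
    then show ?thesis by (simp add: F_def)
  qed
  have lims: "((F \<circ> real_of_ereal) \<longlongrightarrow> 0) (at_right (-\<infinity>))"
    "((F \<circ> real_of_ereal) \<longlongrightarrow> 1 / (1 + a)) (at_left \<infinity>)"
    "((F \<circ> real_of_ereal) \<longlongrightarrow> F x) (at_left (ereal x))"
    using bot top DERIV_isCont[OF deriv, of x]
    by (auto simp: ereal_tendsto_simps isCont_def intro: tendsto_mono[OF at_le[of "{..<x}" UNIV]])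
  have cont: "isCont f y" for y unfolding f_def gumbel_density_def using s by (intro continuous_intros) auto
  \<comment> \<open>For a nonnegative integrand the limits of the antiderivative at both ends give
    integrability together with the value.\<close>
  note FTC = interval_integral_FTC_nonneg[of "-\<infinity>" _ F f, OF _ deriv cont _ lims(1)]
  have inf: "set_integrable lborel UNIV f" "(LBINT x. f x) = 1 / (1 + a)"
    using FTC[of \<infinity>, OF _ _ lims(2)] f_nonneg
    by (auto simp: interval_lebesgue_integral_def einterval_def set_lebesgue_integral_def)
  show "(\<integral>\<^sup>+y. ennreal (f y) \<partial>lborel) = ennreal (1 / (1 + a))"
    using inf f_nonneg unfolding set_integrable_def set_lebesgue_integral_def
    by (subst nn_integral_eq_integral) auto
  have ei: "einterval (-\<infinity>) (ereal x) = {..<x}" by (auto simp: einterval_def)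
  have fin: "set_integrable lborel {..<x} f" "(LBINT y:{..<x}. f y) = F x"
    using FTC[of "ereal x", OF _ _ lims(3)] f_nonneg
    by (auto simp: interval_lebesgue_integral_def ei)
  \<comment> \<open>The interval integral runs over the open half-line; the end point is a null
    set.\<close>
  have "(\<integral>\<^sup>+y\<in>{..x}. ennreal (f y) \<partial>lborel) = (\<integral>\<^sup>+y. ennreal (indicator {..<x} y *\<^sub>R f y) \<partial>lborel)"
    by (intro nn_integral_cong_AE, rule AE_mp[OF AE_lborel_singleton[of x]])
       (auto simp: indicator_def)
  also have "\<dots> = ennreal (F x)"
    using fin f_nonneg unfolding set_integrable_def set_lebesgue_integral_def
    by (subst nn_integral_eq_integral) auto
  finally show "(\<integral>\<^sup>+y\<in>{..x}. ennreal (f y) \<partial>lborel) = ennreal (F x)" .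
qed

section \<open>The smallest eigenvalue of a symmetric matrix\<close>

lemma mult_mat_vec_bounded:
  fixes C :: "real mat"
  assumes C: "C \<in> carrier_mat m n"
  obtains c where "c > 0" "\<And>x. x \<in> carrier_vec n \<Longrightarrow> (C *\<^sub>v x) \<bullet> (C *\<^sub>v x) \<le> c * (x \<bullet> x)"
proof
  \<comment> \<open>The squared Frobenius norm, increased by 1 to be strictly positive even for the
    zero matrix.\<close>
  let ?c = "1 + (\<Sum>i<m. row C i \<bullet> row C i)"
  have nonneg: "v \<bullet> v \<ge> 0" for v :: "real vec"
    by (simp add: scalar_prod_def sum_nonneg)
  then have "(\<Sum>i<m. row C i \<bullet> row C i) \<ge> 0" by (intro sum_nonneg) auto
  then show "?c > 0" by simp
  fix x :: "real vec" assume x: "x \<in> carrier_vec n"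
  have "(C *\<^sub>v x) \<bullet> (C *\<^sub>v x) = (\<Sum>i<m. (row C i \<bullet> x)\<^sup>2)"
    using C by (simp add: scalar_prod_def[of "C *\<^sub>v x"] power2_eq_square atLeast0LessThan)
  also have "\<dots> \<le> (\<Sum>i<m. (row C i \<bullet> row C i) * (x \<bullet> x))"
  proof (rule sum_mono)
    fix i assume "i \<in> {..<m}"
    then show "(row C i \<bullet> x)\<^sup>2 \<le> (row C i \<bullet> row C i) * (x \<bullet> x)"
      using Cauchy_Schwarz_ineq_sum[of "vec_index (row C i)" "vec_index x" "{0..<n}"] x C
      by (simp add: scalar_prod_def power2_eq_square)
  qed
  also have "\<dots> = (\<Sum>i<m. row C i \<bullet> row C i) * (x \<bullet> x)" by (simp add: sum_distrib_right)
  also have "\<dots> \<le> ?c * (x \<bullet> x)" using nonneg[of x] by (simp add: algebra_simps)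
  finally show "(C *\<^sub>v x) \<bullet> (C *\<^sub>v x) \<le> ?c * (x \<bullet> x)" .
qed

text \<open>If the infimum \<open>m\<close> of the Rayleigh quotient were not an eigenvalue, \<open>A - m I\<close> would be
  positive semidefinite and invertible, hence bounded below by a positive multiple of the
  identity.\<close>

lemma rayleigh_inf_eigenvalue:
  fixes A :: "real mat"
  assumes A: "A \<in> carrier_mat n n" and sym: "transpose_mat A = A" and n: "n > 0"
    and lower: "\<And>x. x \<in> carrier_vec n \<Longrightarrow> l * (x \<bullet> x) \<le> x \<bullet> (A *\<^sub>v x)"
  obtains m where "eigenvalue A m" "\<And>x. x \<in> carrier_vec n \<Longrightarrow> m * (x \<bullet> x) \<le> x \<bullet> (A *\<^sub>v x)"
proof -
  define U where "U = {x \<bullet> (A *\<^sub>v x) | x. x \<in> carrier_vec n \<and> x \<bullet> x = 1}"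
  define m where "m = Inf U"
  have bdd: "bdd_below U"
    using lower by (intro bdd_belowI[of _ l]) (force simp: U_def)
  have self0: "x = 0\<^sub>v n" if "x \<in> carrier_vec n" "x \<bullet> x = 0" for x :: "real vec"
  proof -
    have "(\<Sum>i = 0..<n. x $ i * x $ i) = 0" using that by (simp add: scalar_prod_def)
    then have "\<forall>i\<in>{0..<n}. x $ i * x $ i = 0" by (subst (asm) sum_nonneg_eq_0_iff) auto
    then show ?thesis using that by (intro eq_vecI) auto
  qed
  have nonneg: "v \<bullet> v \<ge> 0" for v :: "real vec"
    by (simp add: scalar_prod_def sum_nonneg)
  have U_ne: "U \<noteq> {}"
    using n A by (auto simp: U_def intro!: exI[of _ "unit_vec n 0"])
  have rayleigh: "m * (x \<bullet> x) \<le> x \<bullet> (A *\<^sub>v x)" if x: "x \<in> carrier_vec n" for x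
  proof (cases "x \<bullet> x = 0")
    case True
    then show ?thesis using self0[OF x] A by simp
  next
    case False
    define t where "t = 1 / sqrt (x \<bullet> x)"
    have t: "t * t * (x \<bullet> x) = 1" using False nonneg[of x] by (simp add: t_def)
    have "(t \<cdot>\<^sub>v x) \<bullet> (t \<cdot>\<^sub>v x) = 1" using t x by simp
    moreover have "(t \<cdot>\<^sub>v x) \<bullet> (A *\<^sub>v (t \<cdot>\<^sub>v x)) = t * t * (x \<bullet> (A *\<^sub>v x))"
      using x A by (simp add: mult_mat_vec[OF A x])
    ultimately have "t * t * (x \<bullet> (A *\<^sub>v x)) \<in> U" using x by (auto simp: U_def intro!: exI[of _ "t \<cdot>\<^sub>v x"])
    then have "m \<le> t * t * (x \<bullet> (A *\<^sub>v x))" unfolding m_def by (rule cInf_lower[OF _ bdd])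
    then have "m * (x \<bullet> x) \<le> t * t * (x \<bullet> (A *\<^sub>v x)) * (x \<bullet> x)"
      using nonneg[of x] by (rule mult_right_mono)
    also have "\<dots> = (t * t * (x \<bullet> x)) * (x \<bullet> (A *\<^sub>v x))" by (simp add: mult_ac)
    finally show ?thesis using t by simp
  qed
  define B where "B = char_matrix A m"
  have B: "B \<in> carrier_mat n n" using A by (simp add: B_def)
  have Bv: "B *\<^sub>v x = A *\<^sub>v x - m \<cdot>\<^sub>v x" if "x \<in> carrier_vec n" for x
    using that A unfolding B_def char_matrix_def
    by (intro eq_vecI) (auto simp: add_scalar_prod_distrib[of _ n])
  have QB: "x \<bullet> (B *\<^sub>v x) = x \<bullet> (A *\<^sub>v x) - m * (x \<bullet> x)" if "x \<in> carrier_vec n" for x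
    using that A by (simp add: Bv scalar_prod_minus_distrib[of _ n])
  have psd: "0 \<le> x \<bullet> (B *\<^sub>v x)" if "x \<in> carrier_vec n" for x
    using rayleigh[OF that] QB[OF that] by simp
  have symB: "x \<bullet> (B *\<^sub>v z) = (B *\<^sub>v x) \<bullet> z" if x: "x \<in> carrier_vec n" and z: "z \<in> carrier_vec n" for x z
  proof -
    have "x \<bullet> (A *\<^sub>v z) = (A *\<^sub>v x) \<bullet> z"
      using transpose_vec_mult_scalar[OF A z x] sym by simp
    then show ?thesis using x z A
      by (simp add: Bv scalar_prod_minus_distrib[of _ n] minus_scalar_prod_distrib[of _ n])
  qed
  have "det B = 0"
  proof (rule ccontr)
    assume "det B \<noteq> 0"
    then have "B \<in> Units (ring_mat TYPE(real) n ())" by (rule det_non_zero_imp_unit[OF B])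
    then obtain C where C: "C \<in> carrier_mat n n" and CB: "C * B = 1\<^sub>m n"
      by (auto simp: Units_def ring_mat_def)
    obtain c where c: "c > 0" "\<And>x. x \<in> carrier_vec n \<Longrightarrow> (C *\<^sub>v x) \<bullet> (C *\<^sub>v x) \<le> c * (x \<bullet> x)"
      using mult_mat_vec_bounded[OF C] by blast
    obtain b where b: "b > 0" "\<And>x. x \<in> carrier_vec n \<Longrightarrow> (B *\<^sub>v x) \<bullet> (B *\<^sub>v x) \<le> b * (x \<bullet> x)"
      using mult_mat_vec_bounded[OF B] by blast
    define d where "d = 1 + b"
    have d: "d > 0" using b by (simp add: d_def)
    \<comment> \<open>Expanding |z - B z|^2 \<ge> 0 bounds the quadratic form by the mean of |z|^2
      and |B z|^2.\<close>
    have Qd: "z \<bullet> (B *\<^sub>v z) \<le> d * (z \<bullet> z)" if z: "z \<in> carrier_vec n" for z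
    proof -
      have Bz: "B *\<^sub>v z \<in> carrier_vec n" using B z by auto
      have "0 \<le> (z - B *\<^sub>v z) \<bullet> (z - B *\<^sub>v z)" by (rule nonneg)
      also have "\<dots> = z \<bullet> z - 2 * (z \<bullet> (B *\<^sub>v z)) + (B *\<^sub>v z) \<bullet> (B *\<^sub>v z)"
        using z Bz comm_scalar_prod[OF z Bz]
        by (simp add: scalar_prod_minus_distrib[of _ n] minus_scalar_prod_distrib[of _ n])
      finally have "2 * (z \<bullet> (B *\<^sub>v z)) \<le> (1 + b) * (z \<bullet> z)" using b(2)[OF z] by (simp add: algebra_simps)
      also have "\<dots> \<le> 2 * (d * (z \<bullet> z))" using d nonneg[of z] by (simp add: d_def)
      finally show ?thesis by simp
    qed
    have key: "1 / (c * d) \<le> x \<bullet> (B *\<^sub>v x)" if x: "x \<in> carrier_vec n" "x \<bullet> x = 1"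
      for x :: "real vec"
    proof -
      define z where "z = B *\<^sub>v x"
      have z: "z \<in> carrier_vec n" using B x by (auto simp: z_def)
      have Bz: "B *\<^sub>v z \<in> carrier_vec n" using B z by auto
      have "C *\<^sub>v z = x" unfolding z_def using assoc_mult_mat_vec[OF C B x(1)] CB x by simp
      then have 1: "1 \<le> c * (z \<bullet> z)" using c(2)[OF z] x by simp
      \<comment> \<open>Semidefiniteness is tested at one gradient step
        \<open>x - \<tau> B x\<close> of length \<open>1 / d\<close>. This gives |B x|^2 \<le> d (x,
        B x), while the inverse \<open>C\<close> bounds |B x|^2 below by
        \<open>1 / c\<close>.\<close>
      define \<tau> where "\<tau> = 1 / d"
      define w where "w = x - \<tau> \<cdot>\<^sub>v z"
      have w: "w \<in> carrier_vec n" using x z by (simp add: w_def)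
      have Bw: "B *\<^sub>v w = z - \<tau> \<cdot>\<^sub>v (B *\<^sub>v z)"
        unfolding w_def using mult_minus_distrib_mat_vec[OF B x(1), of "\<tau> \<cdot>\<^sub>v z"] z mult_mat_vec[OF B z]
        by (simp add: z_def)
      have xBz: "x \<bullet> (B *\<^sub>v z) = z \<bullet> z" using symB[OF x(1) z] by (simp add: z_def)
      have "0 \<le> w \<bullet> (B *\<^sub>v w)" by (rule psd[OF w])
      also have "\<dots> = x \<bullet> z - 2 * \<tau> * (z \<bullet> z) + \<tau> * \<tau> * (z \<bullet> (B *\<^sub>v z))"
        unfolding Bw unfolding w_def using x z Bz xBz
        by (simp add: scalar_prod_minus_distrib[of _ n] minus_scalar_prod_distrib[of _ n] algebra_simps)
      also have "\<tau> * \<tau> * (z \<bullet> (B *\<^sub>v z)) \<le> \<tau> * \<tau> * (d * (z \<bullet> z))"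
        using Qd[OF z] by (rule mult_left_mono) simp
      also have "\<tau> * \<tau> * (d * (z \<bullet> z)) = \<tau> * (z \<bullet> z)" using d by (simp add: \<tau>_def)
      finally have "\<tau> * (z \<bullet> z) \<le> x \<bullet> z" by simp
      moreover have "1 / c \<le> z \<bullet> z" using 1 c by (simp add: field_simps)
      then have "\<tau> * (1 / c) \<le> \<tau> * (z \<bullet> z)" using d by (intro mult_left_mono) (auto simp: \<tau>_def)
      ultimately show ?thesis by (simp add: \<tau>_def z_def mult.commute)
    qed
    \<comment> \<open>By \<open>key\<close>, the number on the left would still be a lower bound of
      \<open>U\<close>, which exceeds the infimum.\<close>
    have "m + 1 / (c * d) \<le> m"
      unfolding m_def
    proof (rule cInf_greatest[OF U_ne])
      fix y assume "y \<in> U"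
      then obtain x :: "real vec" where "x \<in> carrier_vec n" "x \<bullet> x = 1" "y = x \<bullet> (A *\<^sub>v x)" by (auto simp: U_def)
      then show "Inf U + 1 / (c * d) \<le> y" using key[of x] QB[of x] by (simp add: m_def)
    qed
    then show False using c d by (simp add: divide_le_0_iff) (smt (verit) mult_pos_pos)
  qed
  then have "eigenvalue A m" using eigenvalue_det[OF A] by (simp add: B_def)
  then show ?thesis using that rayleigh by blast
qed

text \<open>\<open>Min\<close> says something only about a finite nonempty set: finiteness comes
  from the roots of the characteristic polynomial, a member from the infimum of the Rayleigh
  quotient. Testing the form at an eigenvector gives the lower bound \<open>l\<close>.\<close>

lemma min_eigenvalue_bounds:
  fixes A :: "real mat"
  assumes A: "A \<in> carrier_mat n n" and sym: "transpose_mat A = A" and n: "n > 0"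
    and lower: "\<And>x. x \<in> carrier_vec n \<Longrightarrow> l * (x \<bullet> x) \<le> x \<bullet> (A *\<^sub>v x)"
  shows "l \<le> min_eigenvalue A"
    and "x \<in> carrier_vec n \<Longrightarrow> min_eigenvalue A * (x \<bullet> x) \<le> x \<bullet> (A *\<^sub>v x)"
proof -
  obtain m where m: "eigenvalue A m" "\<And>x. x \<in> carrier_vec n \<Longrightarrow> m * (x \<bullet> x) \<le> x \<bullet> (A *\<^sub>v x)"
    using rayleigh_inf_eigenvalue[OF A sym n lower] by blast
  have pos: "x \<bullet> x \<ge> 0" for x :: "real vec"
    by (simp add: scalar_prod_def sum_nonneg)
  have "char_poly A \<noteq> 0" using degree_monic_char_poly[OF A] by auto
  then have fin: "finite {\<mu>. eigenvalue A \<mu>}"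
    unfolding eigenvalue_root_char_poly[OF A] by (rule poly_roots_finite)
  have "l \<le> \<mu>" if \<mu>: "eigenvalue A \<mu>" for \<mu>
  proof -
    obtain v where v: "v \<in> carrier_vec n" "v \<noteq> 0\<^sub>v n" "A *\<^sub>v v = \<mu> \<cdot>\<^sub>v v"
      using \<mu> A by (auto simp: eigenvalue_def eigenvector_def)
    have "v \<bullet> v \<noteq> 0"
    proof
      assume "v \<bullet> v = 0"
      then have "(\<Sum>i = 0..<n. v $ i * v $ i) = 0" using v by (simp add: scalar_prod_def)
      then have "\<forall>i\<in>{0..<n}. v $ i * v $ i = 0" by (subst (asm) sum_nonneg_eq_0_iff) auto
      then have "v = 0\<^sub>v n" using v by (intro eq_vecI) auto
      then show False using v by simp
    qed
    then have "v \<bullet> v > 0" using pos[of v] by simp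
    then show ?thesis using lower[OF v(1)] v by simp
  qed
  moreover have "min_eigenvalue A \<in> {\<mu>. eigenvalue A \<mu>}"
    unfolding min_eigenvalue_def using m fin by (intro Min_in) auto
  ultimately show "l \<le> min_eigenvalue A" by blast
  assume x: "x \<in> carrier_vec n"
  have "min_eigenvalue A \<le> m" unfolding min_eigenvalue_def using m fin by (intro Min_le) auto
  then have "min_eigenvalue A * (x \<bullet> x) \<le> m * (x \<bullet> x)" using pos by (rule mult_right_mono)
  also have "\<dots> \<le> x \<bullet> (A *\<^sub>v x)" by (rule m(2)[OF x])
  finally show "min_eigenvalue A * (x \<bullet> x) \<le> x \<bullet> (A *\<^sub>v x)" .
qed

section \<open>Gumbel comparison and the subgaussian score\<close>

lemma (in prob_space) gumbel_distr:
  assumes X: "random_variable borel X" and s: "s > 0"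
    and cdf: "\<And>x. cdf (distr M borel X) x = gumbel_cdf s x"
  shows "distr M borel X = density lborel (gumbel_density s)"
proof (rule cdf_unique')
  have gd: "gumbel_density s \<in> borel_measurable borel" unfolding gumbel_density_def by measurable
  have em: "emeasure (density lborel (gumbel_density s)) A = (\<integral>\<^sup>+y\<in>A. ennreal (gumbel_density s y) \<partial>lborel)"
    if "A \<in> sets borel" for A
    using that gd by (subst emeasure_density) auto
  have "emeasure (density lborel (gumbel_density s)) UNIV = 1"
    using gumbel_power_integral(2)[OF s, of 0] by (subst em) auto
  then interpret D: prob_space "density lborel (gumbel_density s)"
    by (intro prob_spaceI) simp
  show "finite_borel_measure (density lborel (gumbel_density s))"
    by unfold_locales simp_all
  show "finite_borel_measure (distr M borel X)"
    using X by (intro real_distribution.finite_borel_measure_M real_distribution_distr)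
  show "cdf (distr M borel X) = cdf (density lborel (gumbel_density s))"
  proof
    fix x
    have "emeasure (density lborel (gumbel_density s)) {..x} = ennreal (gumbel_cdf s x)"
      using gumbel_power_integral(1)[OF s, of 0 x] by (subst em) (auto simp: gumbel_cdf_def)
    then have "cdf (density lborel (gumbel_density s)) x = gumbel_cdf s x"
      by (simp add: Distribution_Functions.cdf_def measure_def gumbel_cdf_def)
    then show "cdf (distr M borel X) x = cdf (density lborel (gumbel_density s)) x"
      using cdf by simp
  qed
qed

text \<open>Given \<open>X = u\<close>, the event has probability
  \<open>exp (- a * exp (- (u / s)))\<close> with \<open>a = exp (- (d / s))\<close>; averaging this
  over the Gumbel density of \<open>X\<close> is the integral computed above.\<close>

lemma (in prob_space) gumbel_comparison_prob:
  assumes indep: "indep_var borel X borel Y" and s: "s > 0"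
    and cdf_X: "\<And>x. cdf (distr M borel X) x = gumbel_cdf s x"
    and cdf_Y: "\<And>x. cdf (distr M borel Y) x = gumbel_cdf s x"
  shows "prob {x \<in> space M. Y x \<le> X x + d} = 1 / (1 + exp (- (d / s)))"
proof -
  define a where "a = exp (- (d / s))"
  have a: "a \<ge> 0" by (simp add: a_def)
  have X [measurable]: "random_variable borel X" and Y [measurable]: "random_variable borel Y"
    using indep_var_rv1[OF indep] indep_var_rv2[OF indep] by auto
  let ?DX = "distr M borel X" and ?DY = "distr M borel Y"
  interpret DY: prob_space ?DY by (rule prob_space_distr) fact
  define E where "E = {z :: real \<times> real. snd z \<le> fst z + d}"
  have E: "E \<in> sets (borel \<Otimes>\<^sub>M borel)"
  proof -
    have "{z \<in> space (borel \<Otimes>\<^sub>M borel). snd z \<le> fst z + d} \<in> sets (borel \<Otimes>\<^sub>M (borel :: real measure))"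
      by measurable
    then show ?thesis by (simp add: E_def space_pair_measure)
  qed
  have gd: "gumbel_density s \<in> borel_measurable borel" unfolding gumbel_density_def by measurable
  have "emeasure M {x \<in> space M. Y x \<le> X x + d} = emeasure (distr M (borel \<Otimes>\<^sub>M borel) (\<lambda>x. (X x, Y x))) E"
    using E by (subst emeasure_distr) (auto simp: E_def intro!: arg_cong[of _ _ "emeasure M"])
  also have "distr M (borel \<Otimes>\<^sub>M borel) (\<lambda>x. (X x, Y x)) = ?DX \<Otimes>\<^sub>M ?DY"
    using indep unfolding indep_var_distribution_eq by simp
  also have "emeasure (?DX \<Otimes>\<^sub>M ?DY) E = (\<integral>\<^sup>+u. emeasure ?DY (Pair u -` E) \<partial>?DX)"
    using E by (intro DY.emeasure_pair_measure_alt) simp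
  also have "\<dots> = (\<integral>\<^sup>+u. ennreal (exp (- a * exp (- (u / s)))) \<partial>?DX)"
  proof (rule nn_integral_cong)
    fix u
    have "Pair u -` E = {..u + d}" by (auto simp: E_def)
    then have "emeasure ?DY (Pair u -` E) = ennreal (cdf ?DY (u + d))"
      by (simp add: Distribution_Functions.cdf_def DY.emeasure_eq_measure)
    also have "cdf ?DY (u + d) = exp (- a * exp (- (u / s)))"
      unfolding cdf_Y gumbel_cdf_def a_def by (simp add: exp_add[symmetric] add_divide_distrib)
    finally show "emeasure ?DY (Pair u -` E) = ennreal (exp (- a * exp (- (u / s))))" .
  qed
  also have "\<dots> = (\<integral>\<^sup>+u. ennreal (gumbel_density s u) * ennreal (exp (- a * exp (- (u / s)))) \<partial>lborel)"
    unfolding gumbel_distr[OF X s cdf_X] using gd by (subst nn_integral_density) auto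
  also have "\<dots> = (\<integral>\<^sup>+u. ennreal (exp (- a * exp (- (u / s))) * gumbel_density s u) \<partial>lborel)"
    by (simp add: ennreal_mult'' mult.commute)
  also have "\<dots> = ennreal (1 / (1 + a))" by (rule gumbel_power_integral(2)[OF s a])
  finally show ?thesis using a by (simp add: emeasure_eq_measure a_def)
qed

text \<open>Hoeffding's lemma on [-1, 1]: the length 2 of the interval gives l^2 2^2 / 8 = l^2 / 2.
  The lemma is applied for positive \<open>l\<close>, and negative \<open>l\<close> is reduced to it
  by reflecting \<open>f\<close>.\<close>

lemma (in prob_space) bounded_centered_mgf:
  assumes f: "random_variable borel f" and bound: "\<And>x. x \<in> space M \<Longrightarrow> \<bar>f x\<bar> \<le> 1"
    and mean: "expectation f = 0"
  shows "(\<integral>\<^sup>+x. ennreal (exp (l * f x)) \<partial>M) \<le> ennreal (exp (l\<^sup>2 / 2))"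
proof -
  have pos: "(\<integral>\<^sup>+x. ennreal (exp (l * f x)) \<partial>M) \<le> ennreal (exp (l\<^sup>2 / 2))"
    if l: "l > 0" and f: "random_variable borel f" and bound: "\<And>x. x \<in> space M \<Longrightarrow> \<bar>f x\<bar> \<le> 1"
      and mean: "expectation f = 0" for l f
  proof -
    interpret interval_bounded_random_variable M f "-1" 1
      using f bound by unfold_locales (auto intro!: AE_I2 simp: abs_le_iff minus_le_iff)
    show ?thesis using Hoeffdings_lemma_nn_integral_0[OF l mean] by simp
  qed
  consider "l > 0" | "l = 0" | "l < 0" by linarith
  then show ?thesis
  proof cases
    case 1 then show ?thesis by (rule pos[OF _ f bound mean])
  next
    case 2 then show ?thesis by (simp add: emeasure_space_1)
  next
    case 3
    then show ?thesis using pos[of "- l" "\<lambda>x. - f x"] f bound mean by simp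
  qed
qed

lemma (in prob_space) indep_bounded_centered_mgf:
  assumes I: "finite I" and indep: "indep_vars (\<lambda>_. borel) V I"
    and bound: "\<And>k x. k \<in> I \<Longrightarrow> x \<in> space M \<Longrightarrow> \<bar>V k x\<bar> \<le> 1"
    and mean: "\<And>k. k \<in> I \<Longrightarrow> expectation (V k) = 0"
  shows "(\<integral>\<^sup>+x. ennreal (exp (\<Sum>k\<in>I. w k * V k x)) \<partial>M) \<le> ennreal (exp (sum_prod I w w / 2))"
proof -
  have rv: "random_variable borel (V k)" if "k \<in> I" for k
    using indep that by (auto simp: indep_vars_def)
  have "indep_vars (\<lambda>_. borel) (\<lambda>k x. ennreal (exp (w k * V k x))) I"
    by (rule indep_vars_compose2[OF indep, of "\<lambda>k v. ennreal (exp (w k * v))"]) measurable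
  then have "(\<integral>\<^sup>+x. (\<Prod>k\<in>I. ennreal (exp (w k * V k x))) \<partial>M) = (\<Prod>k\<in>I. \<integral>\<^sup>+x. ennreal (exp (w k * V k x)) \<partial>M)"
    using I by (intro indep_vars_nn_integral) auto
  also have "\<dots> \<le> (\<Prod>k\<in>I. ennreal (exp ((w k)\<^sup>2 / 2)))"
    using rv bound mean by (intro prod_mono_ennreal bounded_centered_mgf) auto
  also have "\<dots> = ennreal (exp (sum_prod I w w / 2))"
    using I by (simp add: prod_ennreal exp_sum[symmetric] sum_prod_def sum_divide_distrib power2_eq_square)
  finally show ?thesis using I by (simp add: prod_ennreal exp_sum)
qed

text \<open>The derivative in \<open>t\<close> of the log-likelihood
  \<open>- ln (1 + exp (- z * t))\<close> of a response \<open>z\<close> at margin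
  \<open>t\<close>.\<close>

definition logit_score :: "real \<Rightarrow> real \<Rightarrow> real" where
  "logit_score t z = z / (1 + exp (z * t))"

lemma logit_score_bound: "\<bar>z\<bar> = 1 \<Longrightarrow> \<bar>logit_score t z\<bar> \<le> 1"
  by (simp add: logit_score_def divide_le_eq add_pos_pos)

lemma (in prob_space) gumbel_response_score_mgf:
  fixes \<epsilon> :: "nat \<Rightarrow> nat \<Rightarrow> 'a \<Rightarrow> real"
  assumes indep: "indep_vars (\<lambda>_. borel) (\<lambda>(i, k). \<epsilon> i k) ({1, 2} \<times> I)" and I: "finite I" and s: "s > 0"
    and gumbel: "\<And>i k x. i \<in> {1, 2} \<Longrightarrow> k \<in> I \<Longrightarrow> cdf (distr M borel (\<epsilon> i k)) x = gumbel_cdf s x"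
    and Z: "\<And>k x. k \<in> I \<Longrightarrow> x \<in> space M \<Longrightarrow> Z k x = (if \<epsilon> 2 k x \<le> \<epsilon> 1 k x + d k then 1 else -1)"
  shows "\<And>k. k \<in> I \<Longrightarrow> random_variable borel (Z k)"
    and "(\<integral>\<^sup>+x. ennreal (exp (\<Sum>k\<in>I. w k * logit_score (d k / s) (Z k x))) \<partial>M) \<le> ennreal (exp (sum_prod I w w / 2))"
proof -
  have rv: "random_variable borel (\<epsilon> i k)" if "i \<in> {1, 2}" "k \<in> I" for i k
  proof -
    have "random_variable borel (case (i, k) of (i, k) \<Rightarrow> \<epsilon> i k)"
      using indep that unfolding indep_vars_def by blast
    then show ?thesis by simp
  qed
  show Zrv: "random_variable borel (Z k)" if k: "k \<in> I" for k
  proof -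
    have [measurable]: "random_variable borel (\<epsilon> 1 k)" "random_variable borel (\<epsilon> 2 k)" using rv k by auto
    have "random_variable borel (\<lambda>x. if \<epsilon> 2 k x \<le> \<epsilon> 1 k x + d k then 1 else -1 :: real)" by measurable
    then show ?thesis by (rule measurable_cong[THEN iffD1, rotated]) (simp add: Z[OF k])
  qed
  \<comment> \<open>\<open>\<phi> k\<close> reads the score off the two noises of question
    \<open>k\<close>. These blocks of indices are disjoint, so the scores inherit independence
    across questions.\<close>
  define \<phi> where "\<phi> k e = logit_score (d k / s) (if e (2::nat, k) \<le> e (1, k) + d k then 1 else -1)" for k and e :: "nat \<times> nat \<Rightarrow> real"
  have "indep_vars (\<lambda>k. PiM ({1, 2} \<times> {k}) (\<lambda>_. borel))
      (\<lambda>k x. restrict (\<lambda>ik. (case ik of (i, k) \<Rightarrow> \<epsilon> i k) x) ({1, 2} \<times> {k})) I"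
    by (rule indep_vars_restrict[OF indep]) (auto simp: disjoint_family_on_def)
  then have "indep_vars (\<lambda>_. borel) (\<lambda>k x. \<phi> k (restrict (\<lambda>ik. (case ik of (i, k) \<Rightarrow> \<epsilon> i k) x) ({1, 2} \<times> {k}))) I"
  proof (rule indep_vars_compose2)
    fix k
    show "\<phi> k \<in> borel_measurable (PiM ({1, 2} \<times> {k}) (\<lambda>_. borel))"
      unfolding \<phi>_def logit_score_def by measurable
  qed
  moreover define V where "V k x = logit_score (d k / s) (if \<epsilon> 2 k x \<le> \<epsilon> 1 k x + d k then 1 else -1)" for k x
  ultimately have indep_V: "indep_vars (\<lambda>_. borel) V I"
    by (elim indep_vars_cong[THEN iffD1, rotated -1]) (auto simp: \<phi>_def V_def)
  have mean: "expectation (V k) = 0" if k: "k \<in> I" for k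
  proof -
    define t where "t = d k / s"
    define A where "A = {x \<in> space M. \<epsilon> 2 k x \<le> \<epsilon> 1 k x + d k}"
    have [measurable]: "random_variable borel (\<epsilon> 1 k)" "random_variable borel (\<epsilon> 2 k)" using rv k by auto
    have A [measurable]: "A \<in> sets M" unfolding A_def by measurable
    have "indep_var borel ((\<lambda>f. f (1, k)) \<circ> (\<lambda>x. restrict (\<lambda>ik. (case ik of (i, k) \<Rightarrow> \<epsilon> i k) x) {(1, k)}))
        borel ((\<lambda>f. f (2, k)) \<circ> (\<lambda>x. restrict (\<lambda>ik. (case ik of (i, k) \<Rightarrow> \<epsilon> i k) x) {(2, k)}))"
      using k by (intro indep_var_compose[OF indep_var_restrict[OF indep]]) auto
    then have "indep_var borel (\<epsilon> 1 k) borel (\<epsilon> 2 k)"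
      by (simp add: comp_def)
    then have pA: "prob A = 1 / (1 + exp (- t))"
      unfolding A_def t_def using s gumbel k by (intro gumbel_comparison_prob) auto
    \<comment> \<open>The two values of the score are one unit apart, so \<open>V k\<close> is a
      constant plus the indicator of \<open>A\<close>; the logistic probability of \<open>A\<close>
      is exactly what cancels that constant.\<close>
    have diff: "logit_score t 1 - logit_score t (-1) = 1"
    proof -
      have "1 + exp t \<noteq> 0" using exp_gt_zero[of t] by linarith
      then show ?thesis by (simp add: logit_score_def exp_minus field_simps)
    qed
    have "expectation (V k) = expectation (\<lambda>x. logit_score t (-1) + indicator A x)"
      using diff by (intro Bochner_Integration.integral_cong) (auto simp: V_def A_def t_def indicator_def)
    also have "\<dots> = logit_score t (-1) + prob A"
      by (subst Bochner_Integration.integral_add)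
        (auto simp: prob_space emeasure_eq_measure intro!: integrable_real_indicator)
    also have "\<dots> = 0" unfolding pA by (simp add: logit_score_def)
    finally show ?thesis .
  qed
  have "(\<integral>\<^sup>+x. ennreal (exp (\<Sum>k\<in>I. w k * logit_score (d k / s) (Z k x))) \<partial>M)
      = (\<integral>\<^sup>+x. ennreal (exp (\<Sum>k\<in>I. w k * V k x)) \<partial>M)"
    by (intro nn_integral_cong arg_cong[of _ _ ennreal] arg_cong[of _ _ exp] sum.cong) (auto simp: V_def Z)
  also have "\<dots> \<le> ennreal (exp (sum_prod I w w / 2))"
  proof (rule indep_bounded_centered_mgf[OF I indep_V _ mean])
    show "\<bar>V k x\<bar> \<le> 1" for k x by (simp add: V_def logit_score_bound)
  qed
  finally show "(\<integral>\<^sup>+x. ennreal (exp (\<Sum>k\<in>I. w k * logit_score (d k / s) (Z k x))) \<partial>M) \<le> ennreal (exp (sum_prod I w w / 2))" .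
qed

section \<open>Strong convexity of the logistic loss\<close>

lemma omega_pos: "omega c > 0"
  by (simp add: omega_def add_pos_pos)

text \<open>The curvature is the reciprocal of e^x + 2 + e^(-x), and each exponential is at most q
  \<le> q^2 for q = e^c \<ge> 1; this produces the denominator of \<open>omega\<close>.\<close>

lemma omega_le_logistic_curvature:
  assumes "\<bar>x\<bar> \<le> c"
  shows "omega c \<le> exp x / (1 + exp x)\<^sup>2"
proof -
  define e q where "e = exp x" and "q = exp c"
  have e: "e > 0" "e \<le> q" "1 \<le> e * q" and q: "1 \<le> q"
    using assms by (auto simp: e_def q_def exp_add[symmetric] abs_le_iff)
  have "q \<le> q\<^sup>2" using q by (simp add: power2_eq_square)
  then have "e * e \<le> e * q\<^sup>2" "e * q \<le> e * q\<^sup>2" using e by auto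
  moreover from this(2) have "1 \<le> e * q\<^sup>2" using e(3) by linarith
  ultimately have "(1 + e)\<^sup>2 \<le> e * (2 + 2 * q\<^sup>2)" by (simp add: power2_eq_square algebra_simps)
  moreover have "exp (2 * c) = q\<^sup>2" by (simp add: q_def exp_double)
  ultimately show ?thesis using e
    by (simp add: omega_def divide_simps add_pos_pos flip: e_def)
qed

text \<open>After subtraction of \<open>omega c / 2 * x\<^sup>2\<close> the loss is still convex on
  [-c, c], so it lies above its tangent at \<open>a\<close>.\<close>

lemma logistic_loss_strong_convexity:
  assumes a: "\<bar>a\<bar> \<le> c" and b: "\<bar>b\<bar> \<le> c"
  shows "- (b - a) / (1 + exp a) + omega c / 2 * (b - a)\<^sup>2 \<le> ln (1 + exp (- b)) - ln (1 + exp (- a))"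
proof -
  let ?f = "\<lambda>x. ln (1 + exp (- x)) - omega c / 2 * x\<^sup>2"
  let ?f' = "\<lambda>x. - 1 / (1 + exp x) - omega c * x"
  have pos: "1 + exp x \<noteq> 0" for x :: real using exp_gt_zero[of x] by linarith
  have "?f' a * (b - a) \<le> ?f b - ?f a"
  proof (rule f''_imp_f'[of "{-c..c}" _ _ "\<lambda>x. exp x / (1 + exp x)\<^sup>2 - omega c"])
    show "(?f has_real_derivative ?f' x) (at x)" for x
      using pos[of x] by (auto intro!: derivative_eq_intros simp: add_pos_pos exp_minus field_simps)
    show "(?f' has_real_derivative exp x / (1 + exp x)\<^sup>2 - omega c) (at x)" for x
      using pos[of x] by (auto intro!: derivative_eq_intros simp: power2_eq_square)
    show "0 \<le> exp x / (1 + exp x)\<^sup>2 - omega c" if "x \<in> {-c..c}" for x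
      using omega_le_logistic_curvature[of x c] that by auto
  qed (use a b in auto)
  then show ?thesis by (simp add: power2_eq_square algebra_simps add_divide_distrib diff_divide_distrib)
qed

text \<open>The loss depends on the response only through \<open>z\<close> times the margin, and a
  sign disappears from the squared difference.\<close>

lemma logit_score_loss_bound:
  assumes z: "z = 1 \<or> z = -1" and t: "\<bar>t\<bar> \<le> c" and m: "\<bar>m\<bar> \<le> c"
  shows "omega c / 2 * (m - t)\<^sup>2 - logit_score t z * (m - t) \<le> ln (1 + exp (- z * m)) - ln (1 + exp (- z * t))"
proof -
  have "z * z = 1" using z by auto
  then have sq: "(z * m - z * t)\<^sup>2 = (m - t)\<^sup>2"
    by (simp add: right_diff_distrib[symmetric] power_mult_distrib power2_eq_square[of z])
  have score: "- (z * m - z * t) / (1 + exp (z * t)) = - (logit_score t z * (m - t))"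
    by (simp add: logit_score_def right_diff_distrib[symmetric])
  have "\<bar>z * t\<bar> \<le> c" "\<bar>z * m\<bar> \<le> c" using z t m by auto
  from logistic_loss_strong_convexity[OF this] show ?thesis
    unfolding sq score by simp
qed

text \<open>Moving from \<open>a\<close> to \<open>a'\<close> does not increase the total loss, so
  the linear gain measured by the score has to pay for the strong convexity.\<close>

lemma likelihood_increase_bound:
  fixes K N :: nat and p :: "nat \<Rightarrow> nat \<Rightarrow> real"
  defines "m \<equiv> \<lambda>a k. \<Sum>j=1..N. p k j * a j"
  assumes z: "\<And>k. k \<in> {1..K} \<Longrightarrow> z k = 1 \<or> z k = -1"
    and a: "\<And>k. k \<in> {1..K} \<Longrightarrow> \<bar>m a k\<bar> \<le> c" and a': "\<And>k. k \<in> {1..K} \<Longrightarrow> \<bar>m a' k\<bar> \<le> c"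
    and le: "log_likelihood K N p z a \<le> log_likelihood K N p z a'"
  shows "omega c / 2 * (\<Sum>k=1..K. (m a' k - m a k)\<^sup>2) \<le> (\<Sum>k=1..K. logit_score (m a k) (z k) * (m a' k - m a k))"
proof -
  have ll: "log_likelihood K N p z a = - (\<Sum>k=1..K. ln (1 + exp (- z k * m a k)))" for a
    unfolding log_likelihood_def m_def by (simp add: sum_distrib_left mult_ac)
  have "(\<Sum>k=1..K. omega c / 2 * (m a' k - m a k)\<^sup>2 - logit_score (m a k) (z k) * (m a' k - m a k))
    \<le> (\<Sum>k=1..K. ln (1 + exp (- z k * m a' k)) - ln (1 + exp (- z k * m a k)))"
    using z a a' by (intro sum_mono logit_score_loss_bound) auto
  also have "\<dots> \<le> 0" using le unfolding ll by (simp add: sum_subtractf)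
  finally show ?thesis by (simp add: sum_subtractf sum_distrib_left)
qed

section \<open>The projected score and the ridge matrix\<close>

lemma expands_in_sum_prod:
  assumes "expands_in I r q x"
  shows "sum_prod I v x = (\<Sum>i<r. sum_prod I (q i) x * sum_prod I (q i) v)"
proof -
  have "sum_prod I v x = sum_prod I v (\<lambda>k. \<Sum>i<r. sum_prod I (q i) x * q i k)"
    using assms unfolding expands_in_def by (intro sum_prod_cong) auto
  then show ?thesis unfolding sum_prod_sum_right by (simp add: sum_prod_commute[of I v])
qed

text \<open>For \<open>x\<close> in the span of \<open>q\<close> only the coordinates of
  \<open>v\<close> along \<open>q\<close> matter. This is how the rank, rather than the number of
  questions, enters the bound.\<close>

lemma expands_in_Cauchy_Schwarz:
  assumes x: "expands_in I r q x"
  shows "(sum_prod I v x)\<^sup>2 \<le> (\<Sum>i<r. (sum_prod I (q i) v)\<^sup>2) * sum_prod I x x"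
proof -
  have "(sum_prod I v x)\<^sup>2 \<le> (\<Sum>i<r. (sum_prod I (q i) x)\<^sup>2) * (\<Sum>i<r. (sum_prod I (q i) v)\<^sup>2)"
    unfolding expands_in_sum_prod[OF x, of v] by (rule Cauchy_Schwarz_ineq_sum)
  then show ?thesis
    unfolding expands_in_sum_prod[OF x, of x] by (simp add: power2_eq_square mult.commute)
qed

text \<open>With D = |x| and the projected length s of \<open>v\<close>, the assumption gives w/2
  D^2 \<le> s D, hence D \<le> 2 s / w and the factor 4. Cancelling D makes \<open>x = 0\<close> a
  separate case.\<close>

lemma quadratic_domination_bound:
  assumes x: "expands_in I r q x" and w: "w > 0" and le: "w / 2 * sum_prod I x x \<le> sum_prod I v x"
  shows "sum_prod I x x \<le> 4 * (\<Sum>i<r. (sum_prod I (q i) v)\<^sup>2) / w\<^sup>2"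
proof -
  let ?S = "\<Sum>i<r. (sum_prod I (q i) v)\<^sup>2" and ?X = "sum_prod I x x"
  have S: "?S \<ge> 0" by (simp add: sum_nonneg)
  have X: "?X \<ge> 0" by (rule sum_prod_self_nonneg)
  have "(w / 2 * ?X)\<^sup>2 \<le> (sum_prod I v x)\<^sup>2" using le X w by (intro power_mono) auto
  also have "\<dots> \<le> ?S * ?X" by (rule expands_in_Cauchy_Schwarz[OF x])
  finally have "(w\<^sup>2 / 4 * ?X) * ?X \<le> ?S * ?X" by (simp add: power2_eq_square mult_ac)
  then have "w\<^sup>2 / 4 * ?X \<le> ?S" if "?X > 0" using that by (rule mult_right_le_imp_le)
  then show ?thesis using S X w by (cases "?X = 0") (auto simp: field_simps)
qed

lemma design_matrix_carrier: "design_matrix K N p \<in> carrier_mat K (N - 1)"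
  by (simp add: design_matrix_def)

lemma Sigma_D_carrier: "Sigma_D K N p \<in> carrier_mat (N - 1) (N - 1)"
  unfolding Sigma_D_def using design_matrix_carrier[of K N p]
  by (intro smult_carrier_mat mult_carrier_mat[of _ _ K]) simp_all

text \<open>Exhibits \<open>Sigma_D\<close> as a scaled Gram matrix. Of the shift by 2, one unit is
  the dropped grid point and one the indexing from 0.\<close>

lemma Sigma_D_index:
  assumes "i < N - 1" "l < N - 1"
  shows "Sigma_D K N p $$ (i, l) = 1 / real K * sum_prod {1..K} (\<lambda>k. p k (i + 2)) (\<lambda>k. p k (l + 2))"
  using assms
  by (simp add: Sigma_D_def design_matrix_def scalar_prod_def sum_prod_def atLeast0LessThan sum.atLeast1_atMost_eq)

lemma ridge_quadratic_form:
  assumes x: "x \<in> carrier_vec (N - 1)"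
  shows "x \<bullet> ((Sigma_D K N p + lam \<cdot>\<^sub>m 1\<^sub>m (N - 1)) *\<^sub>v x)
    = 1 / real K * (\<Sum>k=1..K. (\<Sum>l<N - 1. p k (l + 2) * x $ l)\<^sup>2) + lam * (x \<bullet> x)"
proof -
  let ?P = "design_matrix K N p" and ?n = "N - 1"
  note P = design_matrix_carrier[of K N p]
  have Px: "?P *\<^sub>v x \<in> carrier_vec K" using P x by auto
  have smult: "(r \<cdot>\<^sub>m B) *\<^sub>v x = r \<cdot>\<^sub>v (B *\<^sub>v x)" if "B \<in> carrier_mat ?n ?n" for r B
    using that x by (intro eq_vecI) (auto simp: smult_scalar_prod_distrib[of _ ?n])
  have "(Sigma_D K N p + lam \<cdot>\<^sub>m 1\<^sub>m ?n) *\<^sub>v x = Sigma_D K N p *\<^sub>v x + (lam \<cdot>\<^sub>m 1\<^sub>m ?n) *\<^sub>v x"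
    using x by (intro add_mult_distrib_mat_vec[OF Sigma_D_carrier]) auto
  also have "(lam \<cdot>\<^sub>m 1\<^sub>m ?n) *\<^sub>v x = lam \<cdot>\<^sub>v x"
    using x by (simp add: smult)
  also have "Sigma_D K N p *\<^sub>v x = (1 / real K) \<cdot>\<^sub>v (transpose_mat ?P *\<^sub>v (?P *\<^sub>v x))"
  proof -
    have "Sigma_D K N p *\<^sub>v x = (1 / real K) \<cdot>\<^sub>v ((transpose_mat ?P * ?P) *\<^sub>v x)"
      unfolding Sigma_D_def using P by (intro smult mult_carrier_mat[of _ _ K]) simp_all
    then show ?thesis using assoc_mult_mat_vec[of "transpose_mat ?P" ?n K ?P ?n x] P x by simp
  qed
  finally have "x \<bullet> ((Sigma_D K N p + lam \<cdot>\<^sub>m 1\<^sub>m ?n) *\<^sub>v x)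
      = 1 / real K * (x \<bullet> (transpose_mat ?P *\<^sub>v (?P *\<^sub>v x))) + lam * (x \<bullet> x)"
    using x P by (simp add: scalar_prod_add_distrib[of _ ?n])
  also have "x \<bullet> (transpose_mat ?P *\<^sub>v (?P *\<^sub>v x)) = (?P *\<^sub>v x) \<bullet> (?P *\<^sub>v x)"
  proof -
    have "x \<bullet> (transpose_mat ?P *\<^sub>v (?P *\<^sub>v x)) = (transpose_mat ?P *\<^sub>v (?P *\<^sub>v x)) \<bullet> x"
      using x P by (intro comm_scalar_prod[of _ ?n]) auto
    then show ?thesis using transpose_vec_mult_scalar[OF P x Px] by simp
  qed
  also have "(?P *\<^sub>v x) \<bullet> (?P *\<^sub>v x) = (\<Sum>k=1..K. (\<Sum>l<N - 1. p k (l + 2) * x $ l)\<^sup>2)"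
    using x by (simp add: scalar_prod_def design_matrix_def atLeast0LessThan sum.atLeast1_atMost_eq power2_eq_square)
  finally show ?thesis .
qed

text \<open>The Gram part of the form is nonnegative, so \<open>lam\<close> bounds the whole form
  from below even when \<open>Sigma_D\<close> is singular. The condition \<open>d 1 = 0\<close> lets
  sums over the grid agree with sums over the N - 1 matrix coordinates.\<close>

lemma ridge_min_eigenvalue:
  assumes N: "N \<ge> 2" and lam: "lam > 0"
  shows "min_eigenvalue (Sigma_D K N p + lam \<cdot>\<^sub>m 1\<^sub>m (N - 1)) > 0"
    and "d 1 = 0 \<Longrightarrow> min_eigenvalue (Sigma_D K N p + lam \<cdot>\<^sub>m 1\<^sub>m (N - 1)) * (\<Sum>j=1..N. (d j)\<^sup>2)
      \<le> 1 / real K * (\<Sum>k=1..K. (\<Sum>j=1..N. p k j * d j)\<^sup>2) + lam * (\<Sum>j=1..N. (d j)\<^sup>2)"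
proof -
  let ?A = "Sigma_D K N p + lam \<cdot>\<^sub>m 1\<^sub>m (N - 1)"
  have A: "?A \<in> carrier_mat (N - 1) (N - 1)" using Sigma_D_carrier[of K N p] by simp
  have sym: "transpose_mat ?A = ?A"
    using Sigma_D_carrier[of K N p]
    by (intro eq_matI) (auto simp: Sigma_D_index sum_prod_commute)
  have lower: "lam * (x \<bullet> x) \<le> x \<bullet> (?A *\<^sub>v x)" if "x \<in> carrier_vec (N - 1)" for x
    unfolding ridge_quadratic_form[OF that] by (simp add: sum_nonneg)
  have n: "N - 1 > 0" using N by simp
  have bounds: "lam \<le> min_eigenvalue ?A"
    "\<And>x. x \<in> carrier_vec (N - 1) \<Longrightarrow> min_eigenvalue ?A * (x \<bullet> x) \<le> x \<bullet> (?A *\<^sub>v x)"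
    using min_eigenvalue_bounds[OF A sym n, of lam] lower by blast+
  show "min_eigenvalue ?A > 0" using bounds(1) lam by simp
  assume d: "d 1 = 0"
  define x where "x = vec (N - 1) (\<lambda>l. d (l + 2))"
  have x: "x \<in> carrier_vec (N - 1)" by (simp add: x_def)
  have shift: "(\<Sum>j=1..N. f j) = (\<Sum>l<N - 1. f (l + 2))" if "f 1 = 0" for f :: "nat \<Rightarrow> real"
  proof -
    have "(\<Sum>j=1..N. f j) = (\<Sum>j<Suc (N - 1). f (Suc j))"
      using N by (simp add: sum.atLeast1_atMost_eq)
    also have "\<dots> = f 1 + (\<Sum>l<N - 1. f (l + 2))"
      by (subst sum.lessThan_Suc_shift) simp
    finally show ?thesis using that by simp
  qed
  have "x \<bullet> x = (\<Sum>j=1..N. (d j)\<^sup>2)"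
    using d by (subst shift) (auto simp: scalar_prod_def x_def atLeast0LessThan power2_eq_square)
  moreover have "(\<Sum>l<N - 1. p k (l + 2) * x $ l) = (\<Sum>j=1..N. p k j * d j)" for k
    using d by (subst shift) (auto simp: x_def)
  ultimately show "min_eigenvalue ?A * (\<Sum>j=1..N. (d j)\<^sup>2)
      \<le> 1 / real K * (\<Sum>k=1..K. (\<Sum>j=1..N. p k j * d j)\<^sup>2) + lam * (\<Sum>j=1..N. (d j)\<^sup>2)"
    using bounds(2)[OF x] unfolding ridge_quadratic_form[OF x] by simp
qed

text \<open>The first column of \<open>p\<close> is absent from the design matrix; differences of
  feasible vectors vanish at the first grid point, so it never contributes.\<close>

lemma design_column_space:
  assumes N: "N \<ge> 2" and K: "K \<ge> 1"
  obtains r q where "r \<le> mat_rank (Sigma_D K N p)" "orthonormal {1..K} r q"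
    "\<And>d. d 1 = 0 \<Longrightarrow> expands_in {1..K} r q (\<lambda>k. \<Sum>j=1..N. p k j * d j)"
proof -
  have dim: "dim_row (Sigma_D K N p) = N - 1" using Sigma_D_carrier[of K N p] by simp
  obtain r q where r: "r \<le> mat_rank (Sigma_D K N p)" and q: "orthonormal {1..K} r q"
    and exp: "\<And>l. l < N - 1 \<Longrightarrow> expands_in {1..K} r q (\<lambda>k. p k (l + 2))"
    using gram_matrix_orthonormal[OF _ Sigma_D_carrier _ Sigma_D_index, of K N p] K
    unfolding mat_rank_def dim by auto
  have "expands_in {1..K} r q (\<lambda>k. \<Sum>j=1..N. p k j * d j)" if d: "d 1 = 0" for d :: "nat \<Rightarrow> real"
  proof -
    have "expands_in {1..K} r q (\<lambda>k. \<Sum>j\<in>{2..N}. d j * p k j)"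
    proof (rule expands_in_sum)
      fix j assume "j \<in> {2..N}"
      then obtain l where "j = l + 2" "l < N - 1"
        by (intro that[of "j - 2"]) auto
      then show "expands_in {1..K} r q (\<lambda>k. p k j)" using exp by simp
    qed
    moreover have "(\<Sum>j\<in>{2..N}. d j * p k j) = (\<Sum>j=1..N. p k j * d j)" for k
      using N d by (subst sum.atLeast_Suc_atMost[of 1 N]) (auto simp: mult.commute numeral_2_eq_2)
    ultimately show ?thesis by (simp only:)
  qed
  then show ?thesis using r q that by blast
qed

section \<open>The chi-square tail of the projected score\<close>

text \<open>The linear form \<open>w\<close> is there for the induction. Replacing the square of the
  last coordinate by a Gaussian average adds g sqrt h times \<open>q r\<close> to \<open>w\<close>;
  the sum stays orthogonal to the remaining members of \<open>q\<close>, and by Pythagoras its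
  squared norm grows by h g^2. Integrating over g then yields one factor
  \<open>1 / sqrt (1 - h)\<close> per coordinate.\<close>

lemma nn_integral_gaussian_quadratic_form:
  fixes V :: "'i \<Rightarrow> 'a \<Rightarrow> real" and h :: real
  assumes M: "sigma_finite_measure M" and V: "\<And>k. k \<in> I \<Longrightarrow> V k \<in> borel_measurable M"
    and subgauss: "\<And>w. (\<integral>\<^sup>+x. ennreal (exp (\<Sum>k\<in>I. w k * V k x)) \<partial>M) \<le> ennreal (exp (sum_prod I w w / 2))"
    and h: "0 \<le> h" "h < 1" and q: "orthonormal I r q"
    and w: "\<And>i. i < r \<Longrightarrow> sum_prod I w (q i) = 0"
  shows "(\<integral>\<^sup>+x. ennreal (exp ((\<Sum>k\<in>I. w k * V k x) + h / 2 * (\<Sum>i<r. (sum_prod I (q i) (\<lambda>k. V k x))\<^sup>2))) \<partial>M)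
    \<le> ennreal (exp (sum_prod I w w / 2) * (1 / sqrt (1 - h)) ^ r)"
  using q w
proof (induction r arbitrary: w)
  case 0
  then show ?case using subgauss by simp
next
  case (Suc r)
  interpret M: sigma_finite_measure M by (rule M)
  interpret pair_sigma_finite M "lborel :: real measure"
    by (rule pair_sigma_finite.intro) (simp_all add: M sigma_finite_lborel)
  define \<tau> where "\<tau> = sqrt h"
  have \<tau>: "\<tau> * \<tau> = h" using h by (simp add: \<tau>_def)
  define S where "S = (\<lambda>x. \<Sum>i<r. (sum_prod I (q i) (\<lambda>k. V k x))\<^sup>2)"
  define v where "v = (\<lambda>x. sum_prod I (q r) (\<lambda>k. V k x))"
  define W where "W = (\<lambda>x. \<Sum>k\<in>I. w k * V k x)"
  have meas [measurable]: "S \<in> borel_measurable M" "v \<in> borel_measurable M" "W \<in> borel_measurable M"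
    unfolding S_def v_def W_def sum_prod_def using V by measurable
  have qr: "sum_prod I (q r) (q r) = 1" "\<And>i. i < r \<Longrightarrow> sum_prod I (q r) (q i) = 0"
    using Suc.prems(1) by (auto simp: orthonormal_def)
  have q: "orthonormal I r q" using Suc.prems(1) by (auto simp: orthonormal_def)
  have wr: "sum_prod I w (q i) = 0" if "i < Suc r" for i using Suc.prems(2)[OF that] .
  define C where "C = exp (sum_prod I w w / 2) * (1 / sqrt (1 - h)) ^ r"
  have C: "C \<ge> 0" using h by (simp add: C_def)
  have inner: "(\<integral>\<^sup>+x. ennreal (exp (W x + g * (\<tau> * v x) + h / 2 * S x)) \<partial>M) \<le> ennreal (C * exp (h * g\<^sup>2 / 2))" for g
  proof -
    define w' where "w' = (\<lambda>k. w k + g * \<tau> * q r k)"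
    have right: "sum_prod I z w' = sum_prod I w' z" for z by (rule sum_prod_commute)
    have left: "sum_prod I w' z = sum_prod I w z + g * \<tau> * sum_prod I (q r) z" for z
      unfolding w'_def by (simp only: sum_prod_add_left sum_prod_scale_left)
    have "sum_prod I w' w' = sum_prod I w w + g * \<tau> * (g * \<tau>)"
      unfolding left[of w'] right[of w] right[of "q r"] left[of w] left[of "q r"] qr(1)
      using wr[of r] by (simp add: sum_prod_commute[of I "q r" w])
    then have norm: "sum_prod I w' w' = sum_prod I w w + h * g\<^sup>2"
      using \<tau> by (simp add: power2_eq_square mult_ac)
    have "(\<Sum>k\<in>I. w' k * V k x) = W x + g * (\<tau> * v x)" for x
      unfolding W_def v_def w'_def sum_prod_def by (simp add: algebra_simps sum.distrib sum_distrib_left)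
    moreover have "sum_prod I w' (q i) = 0" if "i < r" for i
      unfolding left using wr[of i] qr(2)[OF that] that by simp
    ultimately have "(\<integral>\<^sup>+x. ennreal (exp (W x + g * (\<tau> * v x) + h / 2 * S x)) \<partial>M)
        \<le> ennreal (exp (sum_prod I w' w' / 2) * (1 / sqrt (1 - h)) ^ r)"
      using Suc.IH[OF q, of w'] by (simp add: S_def)
    also have "exp (sum_prod I w' w' / 2) * (1 / sqrt (1 - h)) ^ r = C * exp (h * g\<^sup>2 / 2)"
      unfolding norm C_def by (simp add: add_divide_distrib exp_add)
    finally show ?thesis .
  qed
  have "(\<integral>\<^sup>+x. ennreal (exp (W x + h / 2 * (S x + (v x)\<^sup>2))) \<partial>M)
      = (\<integral>\<^sup>+x. \<integral>\<^sup>+g. ennreal (std_normal_density g * exp (W x + g * (\<tau> * v x) + h / 2 * S x)) \<partial>lborel \<partial>M)"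
  proof (rule nn_integral_cong)
    fix x
    have "(\<integral>\<^sup>+g. ennreal (std_normal_density g * exp (W x + g * (\<tau> * v x) + h / 2 * S x)) \<partial>lborel)
      = (\<integral>\<^sup>+g. ennreal (exp (W x + h / 2 * S x)) * ennreal (std_normal_density g * exp (g * (\<tau> * v x))) \<partial>lborel)"
      by (intro nn_integral_cong, subst ennreal_mult[symmetric]) (auto simp: exp_add)
    also have "\<dots> = ennreal (exp (W x + h / 2 * S x)) * ennreal (exp ((\<tau> * v x)\<^sup>2 / 2))"
      by (subst nn_integral_cmult) (auto simp: nn_integral_gaussian_exp)
    also have "\<dots> = ennreal (exp (W x + h / 2 * (S x + (v x)\<^sup>2)))"
      using \<tau> by (subst ennreal_mult[symmetric])
        (auto simp: exp_add[symmetric] power_mult_distrib algebra_simps power2_eq_square[of \<tau>])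
    finally show "ennreal (exp (W x + h / 2 * (S x + (v x)\<^sup>2)))
      = (\<integral>\<^sup>+g. ennreal (std_normal_density g * exp (W x + g * (\<tau> * v x) + h / 2 * S x)) \<partial>lborel)" ..
  qed
  also have "\<dots> = (\<integral>\<^sup>+g. \<integral>\<^sup>+x. ennreal (std_normal_density g * exp (W x + g * (\<tau> * v x) + h / 2 * S x)) \<partial>M \<partial>lborel)"
    by (rule Fubini'[symmetric]) (unfold normal_density_def, measurable)
  also have "\<dots> \<le> (\<integral>\<^sup>+g. ennreal C * ennreal (std_normal_density g * exp (h * g\<^sup>2 / 2)) \<partial>lborel)"
  proof (rule nn_integral_mono)
    fix g :: real
    have "(\<integral>\<^sup>+x. ennreal (std_normal_density g * exp (W x + g * (\<tau> * v x) + h / 2 * S x)) \<partial>M)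
        = (\<integral>\<^sup>+x. ennreal (std_normal_density g) * ennreal (exp (W x + g * (\<tau> * v x) + h / 2 * S x)) \<partial>M)"
      by (simp add: ennreal_mult)
    also have "\<dots> = ennreal (std_normal_density g) * (\<integral>\<^sup>+x. ennreal (exp (W x + g * (\<tau> * v x) + h / 2 * S x)) \<partial>M)"
      by (rule nn_integral_cmult) measurable
    also have "\<dots> \<le> ennreal (std_normal_density g) * ennreal (C * exp (h * g\<^sup>2 / 2))"
      by (rule mult_left_mono[OF inner]) simp
    also have "\<dots> = ennreal C * ennreal (std_normal_density g * exp (h * g\<^sup>2 / 2))"
      using C by (simp add: ennreal_mult[symmetric] mult_ac)
    finally show "(\<integral>\<^sup>+x. ennreal (std_normal_density g * exp (W x + g * (\<tau> * v x) + h / 2 * S x)) \<partial>M)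
        \<le> ennreal C * ennreal (std_normal_density g * exp (h * g\<^sup>2 / 2))" .
  qed
  also have "\<dots> = ennreal C * ennreal (1 / sqrt (1 - h))"
    using h by (subst nn_integral_cmult) (auto simp: nn_integral_gaussian_exp_square)
  also have "\<dots> = ennreal (exp (sum_prod I w w / 2) * (1 / sqrt (1 - h)) ^ Suc r)"
    using C h by (subst ennreal_mult[symmetric]) (auto simp: C_def)
  finally show ?case by (simp add: W_def S_def v_def)
qed

text \<open>Both sides vanish at 1, and their difference has derivative - (1 - 1/t)^2 / 2.\<close>

lemma ln_le_half_diff_inverse:
  fixes x :: real
  assumes "x \<ge> 1"
  shows "ln x \<le> (x - 1 / x) / 2"
proof -
  have "ln x - (x - 1 / x) / 2 \<le> ln 1 - (1 - 1 / 1) / (2::real)"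
  proof (rule DERIV_nonpos_imp_nonincreasing[OF assms])
    fix t :: real assume t: "1 \<le> t" "t \<le> x"
    have "((\<lambda>t. ln t - (t - 1 / t) / 2) has_real_derivative 1 / t - (1 + 1 / t\<^sup>2) / 2) (at t)"
      using t by (auto intro!: derivative_eq_intros simp: power2_eq_square field_simps)
    moreover have "1 / t - (1 + 1 / t\<^sup>2) / 2 = - (1 - 1 / t)\<^sup>2 / 2"
      using t by (simp add: power2_eq_square field_simps)
    then have "1 / t - (1 + 1 / t\<^sup>2) / 2 \<le> 0" by simp
    ultimately show "\<exists>y. ((\<lambda>t. ln t - (t - 1 / t) / 2) has_real_derivative y) (at t) \<and> y \<le> 0" by blast
  qed
  then show ?thesis by simp
qed

lemma chi_square_chernoff:
  fixes t :: real
  assumes R: "R > 0" and t: "t > 0"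
  obtains h where "0 < h" "h < 1"
    "exp (- (h / 2 * (real R + 2 * sqrt (real R * t) + 2 * t))) * (1 / sqrt (1 - h)) ^ R \<le> exp (- t)"
proof -
  define a where "a = sqrt (t / R)"
  \<comment> \<open>This is the Laurent-Massart choice: u = h/2 = a / (1 + 2 a) maximizes u x - R
    u^2 / (1 - 2 u) at x = 2 sqrt (R t) + 2 t, with maximum t. The subtracted term bounds the
    logarithmic moment generating function of a centered chi-square variable.\<close>
  define h where "h = 2 * a / (1 + 2 * a)"
  have a: "a > 0" using R t by (simp add: a_def)
  have ta: "t = R * (a * a)" using R t by (simp add: a_def)
  have "sqrt (real R * t) = R * a"
    unfolding ta using a R by (simp add: real_sqrt_mult)
  have h1: "1 - h = 1 / (1 + 2 * a)" using a by (simp add: h_def field_simps)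
  have h: "0 < h" "h < 1" using a by (simp_all add: h_def)
  have "(1 / sqrt (1 - h)) ^ R = sqrt (1 + 2 * a) ^ R"
    using a by (simp add: h1 real_sqrt_divide)
  also have "sqrt (1 + 2 * a) = exp (ln (1 + 2 * a) / 2)"
    using a by (simp add: exp_ln_iff ln_sqrt[symmetric])
  also have "exp (ln (1 + 2 * a) / 2) ^ R = exp (R * (ln (1 + 2 * a) / 2))"
    by (simp add: exp_of_nat_mult[symmetric])
  finally have pow: "(1 / sqrt (1 - h)) ^ R = exp (R * (ln (1 + 2 * a) / 2))" .
  have "ln (1 + 2 * a) / 2 \<le> ((1 + 2 * a) - 1 / (1 + 2 * a)) / 2 / 2"
    using ln_le_half_diff_inverse[of "1 + 2 * a"] a by simp
  \<comment> \<open>Both sides are (a + a^2) / (1 + 2 a), so the logarithm estimate is the only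
    loss.\<close>
  also have "\<dots> = h / 2 * (1 + 2 * a + 2 * (a * a)) - a * a"
    using a by (simp add: h_def field_simps)
  finally have "R * (ln (1 + 2 * a) / 2) \<le> R * (h / 2 * (1 + 2 * a + 2 * (a * a)) - a * a)"
    by (rule mult_left_mono) simp
  also have "\<dots> = h / 2 * (real R + 2 * sqrt (real R * t) + 2 * t) - t"
    unfolding \<open>sqrt (real R * t) = R * a\<close> by (simp add: ta algebra_simps)
  finally have "exp (- (h / 2 * (real R + 2 * sqrt (real R * t) + 2 * t))) * (1 / sqrt (1 - h)) ^ R \<le> exp (- t)"
    unfolding pow exp_add[symmetric] by simp
  then show ?thesis using that h by blast
qed

text \<open>Markov's inequality for \<open>exp (h / 2 * S x)\<close>. Since
  \<open>1 / sqrt (1 - h)\<close> is at least 1, the exponent \<open>r\<close> may be raised to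
  \<open>R\<close>. For \<open>R = 0\<close> the parameter of the Chernoff bound would divide by
  zero, but then the sum is empty and stays below the threshold.\<close>

lemma (in prob_space) quadratic_form_tail:
  fixes V :: "'i \<Rightarrow> 'a \<Rightarrow> real" and t :: real
  assumes V: "\<And>k. k \<in> I \<Longrightarrow> V k \<in> borel_measurable M"
    and subgauss: "\<And>w. (\<integral>\<^sup>+x. ennreal (exp (\<Sum>k\<in>I. w k * V k x)) \<partial>M) \<le> ennreal (exp (sum_prod I w w / 2))"
    and q: "orthonormal I r q" and r: "r \<le> R" and t: "t > 0"
  shows "prob {x \<in> space M. (\<Sum>i<r. (sum_prod I (q i) (\<lambda>k. V k x))\<^sup>2) > real R + 2 * sqrt (real R * t) + 2 * t}
    \<le> exp (- t)"
proof (cases "R = 0")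
  case True
  then show ?thesis using r t by simp
next
  case False
  define T where "T = real R + 2 * sqrt (real R * t) + 2 * t"
  obtain h where h: "0 < h" "h < 1"
    and hT: "exp (- (h / 2 * T)) * (1 / sqrt (1 - h)) ^ R \<le> exp (- t)"
    using chi_square_chernoff[of R t] False t unfolding T_def by blast
  define S where "S = (\<lambda>x. \<Sum>i<r. (sum_prod I (q i) (\<lambda>k. V k x))\<^sup>2)"
  have [measurable]: "S \<in> borel_measurable M" unfolding S_def sum_prod_def using V by measurable
  have "emeasure M {x \<in> space M. S x > T} \<le> (\<integral>\<^sup>+x. ennreal (exp (- (h / 2 * T))) * ennreal (exp (h / 2 * S x)) \<partial>M)"
  proof -
    have "emeasure M {x \<in> space M. S x > T} = (\<integral>\<^sup>+x. indicator {x \<in> space M. S x > T} x \<partial>M)"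
      by simp
    also have "\<dots> \<le> (\<integral>\<^sup>+x. ennreal (exp (- (h / 2 * T))) * ennreal (exp (h / 2 * S x)) \<partial>M)"
    proof (rule nn_integral_mono)
      fix x
      have "1 \<le> exp (- (h / 2 * T)) * exp (h / 2 * S x)" if "S x > T"
        unfolding exp_add[symmetric] using that h by simp
      then show "indicator {x \<in> space M. S x > T} x \<le> ennreal (exp (- (h / 2 * T))) * ennreal (exp (h / 2 * S x))"
        by (auto simp: indicator_def ennreal_mult[symmetric])
    qed
    finally show ?thesis .
  qed
  also have "\<dots> = ennreal (exp (- (h / 2 * T))) * (\<integral>\<^sup>+x. ennreal (exp (h / 2 * S x)) \<partial>M)"
    by (rule nn_integral_cmult) measurable
  also have "(\<integral>\<^sup>+x. ennreal (exp (h / 2 * S x)) \<partial>M) \<le> ennreal ((1 / sqrt (1 - h)) ^ r)"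
    using nn_integral_gaussian_quadratic_form[where w = "\<lambda>_. 0" and h = h,
        OF sigma_finite_measure_axioms V subgauss _ _ q] h
    by (simp add: S_def sum_prod_def)
  also have "ennreal ((1 / sqrt (1 - h)) ^ r) \<le> ennreal ((1 / sqrt (1 - h)) ^ R)"
    using h r by (intro ennreal_leI power_increasing) auto
  also have "ennreal (exp (- (h / 2 * T))) * \<dots> \<le> ennreal (exp (- t))"
    using hT h by (subst ennreal_mult[symmetric]) (auto intro!: ennreal_leI)
  finally have "emeasure M {x \<in> space M. S x > T} \<le> ennreal (exp (- t))"
    by (simp add: mult_left_mono)
  then show ?thesis unfolding S_def T_def by (simp add: emeasure_eq_measure)
qed

section \<open>Feasible vectors, margins and measurability\<close>

text \<open>Slopes decrease along the grid and the last one is nonnegative, so a downward induction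
  makes all of them nonnegative; the values then increase from 0 to \<gamma> \<le> c.\<close>

lemma mle_feasible_range:
  assumes feas: "mle_feasible c L N y a \<beta> \<gamma>" and y: "strict_mono_on {1..N} y" and N: "N \<ge> 2"
    and j: "j \<in> {1..N}"
  shows "0 \<le> a j" "a j \<le> c"
proof -
  have \<beta>: "0 \<le> \<beta> i" if "1 \<le> i" "i \<le> N - 1" for i
    using that(2,1)
  proof (induction rule: inc_induct)
    case base
    then show ?case using feas unfolding mle_feasible_def by blast
  next
    case (step i)
    then have "i \<in> {1..N-2}" by auto
    then have "\<beta> (i + 1) \<le> \<beta> i" using feas unfolding mle_feasible_def by blast
    then show ?case using step by simp
  qed
  have incr: "a i \<le> a (Suc i)" if "1 \<le> i" "Suc i \<le> N" for i
  proof -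
    have "y i < y (i + 1)" using y that by (auto simp: strict_mono_on_def)
    moreover have "\<beta> i = (a (i + 1) - a i) / (y (i + 1) - y i)" "0 \<le> \<beta> i"
      using feas \<beta>[of i] that unfolding mle_feasible_def by auto
    ultimately show ?thesis by (auto simp: zero_le_divide_iff)
  qed
  have mono: "a i \<le> a k" if "i \<le> k" "1 \<le> i" "k \<le> N" for i k
    using that
  proof (induction rule: dec_induct)
    case (step k)
    then show ?case using incr[of k] by simp
  qed simp
  show "0 \<le> a j" "a j \<le> c"
    using mono[of 1 j] mono[of j N] j feas unfolding mle_feasible_def by auto
qed

lemma concave_on_slope_antimono:
  fixes f :: "real \<Rightarrow> real"
  assumes f: "concave_on S f" and xyz: "x \<in> S" "z \<in> S" "x < y" "y < z"
  shows "(f z - f y) / (z - y) \<le> (f y - f x) / (y - x)"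
proof -
  define t where "t = (y - x) / (z - x)"
  have t: "0 \<le> t" "t \<le> 1" using xyz by (auto simp: t_def)
  have "(1 - t) * x + t * z = x + t * (z - x)" by (simp add: algebra_simps)
  also have "\<dots> = y" using xyz by (simp add: t_def)
  finally have "(1 - t) * f x + t * f z \<le> f y"
    using concave_onD[OF f t xyz(1,2)] by simp
  then have "(z - x) * ((1 - t) * f x + t * f z) \<le> (z - x) * f y"
    using xyz by (intro mult_left_mono) auto
  moreover have "(z - x) * ((1 - t) * f x + t * f z) = (z - x) * f x + ((z - x) * t) * (f z - f x)"
    by (simp add: algebra_simps)
  moreover have "(z - x) * t = y - x" using xyz by (simp add: t_def)
  ultimately have "(z - x) * f x + (y - x) * (f z - f x) \<le> (z - x) * f y" by (simp only:)
  then have "(f z - f y) * (y - x) \<le> (f y - f x) * (z - y)" by (simp add: algebra_simps)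
  then show ?thesis using xyz by (simp add: divide_simps mult.commute)
qed

text \<open>This lets the true vector compete in the maximization. The lower bound on the scale
  makes \<gamma> = 1/\<sigma> admissible; concavity, the Lipschitz bound and monotonicity become the
  constraints on consecutive, first and last slopes.\<close>

lemma scaled_utility_feasible:
  assumes u: "u \<in> concave_utilities b L" and \<sigma>: "\<sigma> \<ge> 1 / c" and c: "c > 0" and N: "N \<ge> 2"
    and y: "strict_mono_on {1..N} y" and range: "\<And>j. j \<in> {1..N} \<Longrightarrow> y j \<in> {0..b}"
    and ends: "y 1 = 0" "y N = b"
  shows "mle_feasible c L N y (\<lambda>j. u (y j) / \<sigma>)
    (\<lambda>j. (u (y (j + 1)) / \<sigma> - u (y j) / \<sigma>) / (y (j + 1) - y j)) (1 / \<sigma>)"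
proof -
  have \<sigma>0: "\<sigma> > 0" using \<sigma> c by (smt (verit) divide_pos_pos)
  have less: "y j < y (j + 1)" if "j \<ge> 1" "j + 1 \<le> N" for j
    using y that by (auto simp: strict_mono_on_def)
  have uf: "mono_on {0..b} u" "concave_on {0..b} u" "lipschitz_on L {0..b} u" "u 0 = 0" "u b = 1"
    using u by (auto simp: concave_utilities_def)
  define s where "s j = (u (y (j + 1)) - u (y j)) / (y (j + 1) - y j)" for j
  have slope: "(u (y (j + 1)) / \<sigma> - u (y j) / \<sigma>) / (y (j + 1) - y j) = s j / \<sigma>" for j
    by (simp add: s_def diff_divide_distrib[symmetric])
  have "1 / \<sigma> \<le> c" using \<sigma> \<sigma>0 c by (simp add: field_simps)
  moreover have "s (j + 1) / \<sigma> \<le> s j / \<sigma>" if "j \<in> {1..N-2}" for j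
    unfolding s_def using that less[of j] less[of "j + 1"] range[of j] range[of "j + 2"] \<sigma>0
    by (intro divide_right_mono concave_on_slope_antimono[OF uf(2)]) auto
  moreover have "s 1 / \<sigma> \<le> L * (1 / \<sigma>)"
  proof -
    have "\<bar>u (y 2) - u (y 1)\<bar> \<le> L * \<bar>y 2 - y 1\<bar>"
      using lipschitz_onD[OF uf(3), of "y 2" "y 1"] range N by (simp add: dist_real_def)
    moreover have "y 1 < y 2" using less[of 1] N by (simp add: numeral_2_eq_2)
    ultimately have "s 1 \<le> L" by (simp add: s_def numeral_2_eq_2 divide_le_eq)
    then show ?thesis using \<sigma>0 by (simp add: divide_right_mono)
  qed
  moreover have "0 \<le> s (N - 1) / \<sigma>"
  proof -
    have n: "1 \<le> N - 1" "N - 1 + 1 = N" using N by auto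
    then have less_N: "y (N - 1) < y N" using less[of "N - 1"] by simp
    then have "u (y (N - 1)) \<le> u (y N)"
      using range[of "N - 1"] range[of N] n N by (intro mono_onD[OF uf(1)]) auto
    then show ?thesis unfolding s_def n using less_N \<sigma>0 by simp
  qed
  ultimately show ?thesis
    unfolding mle_feasible_def slope using \<sigma>0 uf ends by simp
qed

text \<open>The grid carries the whole mass of \<open>W\<close>, so the sum is a mean of values in
  [0, c]. A margin is a difference of two such means and stays in [-c, c], where
  \<open>omega\<close> bounds the curvature.\<close>

lemma pmf_weighted_sum_bounds:
  fixes a :: "nat \<Rightarrow> real"
  assumes inj: "inj_on y {1..N}" and W: "set_pmf W \<subseteq> y ` {1..N}"
    and a: "\<And>j. j \<in> {1..N} \<Longrightarrow> 0 \<le> a j" "\<And>j. j \<in> {1..N} \<Longrightarrow> a j \<le> c"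
  shows "0 \<le> (\<Sum>j=1..N. pmf W (y j) * a j)" "(\<Sum>j=1..N. pmf W (y j) * a j) \<le> c"
proof -
  show "0 \<le> (\<Sum>j=1..N. pmf W (y j) * a j)" using a by (intro sum_nonneg mult_nonneg_nonneg) auto
  have "(\<Sum>j=1..N. pmf W (y j) * a j) \<le> (\<Sum>j=1..N. pmf W (y j) * c)"
    using a by (intro sum_mono mult_left_mono) auto
  also have "\<dots> = (\<Sum>x\<in>y ` {1..N}. pmf W x) * c"
    unfolding sum.reindex[OF inj] by (simp add: sum_distrib_right)
  also have "(\<Sum>x\<in>y ` {1..N}. pmf W x) = 1" using W by (intro sum_pmf_eq_1) auto
  finally show "(\<Sum>j=1..N. pmf W (y j) * a j) \<le> c" by simp
qed

lemma expected_utility_grid: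
  fixes y :: "nat \<Rightarrow> real"
  assumes inj: "inj_on y {1..N}" and W: "set_pmf W \<subseteq> y ` {1..N}"
  shows "expected_utility u W = (\<Sum>j=1..N. pmf W (y j) * u (y j))"
proof -
  have "expected_utility u W = (\<Sum>x\<in>y ` {1..N}. u x * pmf W x)"
    unfolding expected_utility_def using W by (intro integral_measure_pmf_real) auto
  then show ?thesis unfolding sum.reindex[OF inj] by (simp add: mult.commute)
qed

lemma mle_optimal_cong:
  assumes "\<And>k. k \<in> {1..K} \<Longrightarrow> z k = z' k"
  shows "mle_optimal c L K N y p z a \<beta> \<gamma> \<longleftrightarrow> mle_optimal c L K N y p z' a \<beta> \<gamma>"
proof -
  have "log_likelihood K N p z = log_likelihood K N p z'"
    unfolding log_likelihood_def using assms by (intro ext arg_cong[of _ _ uminus] sum.cong) auto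
  then show ?thesis by (simp add: mle_optimal_def)
qed

text \<open>For nonzero \<gamma> the two divisions cancel, and for \<gamma> = 0 the convention gives
  the same value; error bounds can thus speak of the maximizer itself.\<close>

lemma MLE_ratio_eq [simp]: "MLE_ratio a \<gamma> j = a j"
  by (simp add: MLE_ratio_def alpha_MLE_def sigma_MLE_def)

lemma Linf_norm_le_L2_norm:
  assumes "N \<ge> 1"
  shows "Linf_norm N v \<le> L2_norm N v"
  unfolding Linf_norm_def L2_norm_def
proof (rule Max.boundedI)
  fix x assume "x \<in> (\<lambda>j. \<bar>v j\<bar>) ` {1..N}"
  then obtain j where j: "j \<in> {1..N}" "x = \<bar>v j\<bar>" by blast
  have "\<bar>v j\<bar> \<le> L2_set (\<lambda>j. \<bar>v j\<bar>) {1..N}" using j by (intro member_le_L2_set) auto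
  then show "x \<le> L2_set v {1..N}" using j by (simp add: L2_set_def)
qed (use assms in auto)

text \<open>\<open>Q\<close> may quantify over uncountably many candidates (here, all optimal solutions), so
  measurability has to come from the finitely many values of the responses.\<close>

lemma measurable_finite_valued_event:
  fixes Z :: "'i \<Rightarrow> 'a \<Rightarrow> real"
  assumes I: "finite I" and Z: "\<And>k. k \<in> I \<Longrightarrow> Z k \<in> borel_measurable M"
    and B: "finite B" and Zvals: "\<And>k x. k \<in> I \<Longrightarrow> x \<in> space M \<Longrightarrow> Z k x \<in> B"
    and Q: "\<And>z z'. (\<And>k. k \<in> I \<Longrightarrow> z k = z' k) \<Longrightarrow> Q z \<Longrightarrow> Q z'"
  shows "{x \<in> space M. Q (\<lambda>k. Z k x)} \<in> sets M"
proof -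
  let ?F = "{z \<in> PiE I (\<lambda>_. B). Q z}"
  have "{x \<in> space M. Q (\<lambda>k. Z k x)} = (\<Union>z\<in>?F. {x \<in> space M. \<forall>k\<in>I. Z k x = z k})"
  proof (intro equalityI subsetI)
    fix x assume x: "x \<in> {x \<in> space M. Q (\<lambda>k. Z k x)}"
    let ?z = "restrict (\<lambda>k. Z k x) I"
    have "?z \<in> PiE I (\<lambda>_. B)" using Zvals x by auto
    moreover have "Q ?z" by (rule Q[of "\<lambda>k. Z k x"]) (use x in auto)
    ultimately show "x \<in> (\<Union>z\<in>?F. {x \<in> space M. \<forall>k\<in>I. Z k x = z k})"
      using x by (intro UN_I[of ?z]) auto
  next
    fix x assume "x \<in> (\<Union>z\<in>?F. {x \<in> space M. \<forall>k\<in>I. Z k x = z k})"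
    then obtain z where "Q z" "x \<in> space M" "\<forall>k\<in>I. Z k x = z k" by blast
    then show "x \<in> {x \<in> space M. Q (\<lambda>k. Z k x)}" using Q[of z "\<lambda>k. Z k x"] by auto
  qed
  also have "\<dots> \<in> sets M"
  proof (rule sets.finite_UN)
    show "finite ?F" using I B by (simp add: finite_PiE)
    fix z
    show "{x \<in> space M. \<forall>k\<in>I. Z k x = z k} \<in> sets M"
      using Z I by measurable
  qed
  finally show ?thesis .
qed

section \<open>From the tail event to the error bound\<close>

text \<open>Squaring the sum of roots gives 2 \<rho> + B plus twice a product of roots, and that
  product is at least \<rho>.\<close>

lemma sqrt_sum_bound:
  fixes \<rho> B D m :: real
  assumes \<rho>: "\<rho> \<ge> 0" and B: "B \<ge> 0" and m: "m > 0" and le: "m * D\<^sup>2 \<le> 4 * \<rho> + B"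
  shows "D \<le> (sqrt \<rho> + sqrt (\<rho> + B)) / sqrt m"
proof -
  have "\<rho> \<le> sqrt \<rho> * sqrt (\<rho> + B)"
    using \<rho> B mult_left_mono[of "sqrt \<rho>" "sqrt (\<rho> + B)" "sqrt \<rho>"] by simp
  then have "4 * \<rho> + B \<le> (sqrt \<rho> + sqrt (\<rho> + B))\<^sup>2"
    using \<rho> B by (simp add: power2_sum)
  then have "(sqrt m * D)\<^sup>2 \<le> (sqrt \<rho> + sqrt (\<rho> + B))\<^sup>2"
    using le m by (simp add: power_mult_distrib)
  then have "sqrt m * D \<le> sqrt \<rho> + sqrt (\<rho> + B)"
    by (rule power2_le_imp_le) (use \<rho> B in simp)
  then show ?thesis using m by (simp add: pos_le_divide_eq mult.commute)
qed

text \<open>The deterministic half: the responses are fixed, and randomness survives only as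
  assumption \<open>S\<close> on the projected score.\<close>

lemma mle_error_bound:
  assumes c: "c > 0" and K: "K \<ge> 1" and N: "N \<ge> 2" and lam: "lam > 0" and \<delta>: "0 < \<delta>" "\<delta> < 1"
    and y: "strict_mono_on {1..N} y"
    and p: "\<And>k a. k \<in> {1..K} \<Longrightarrow> \<forall>j\<in>{1..N}. 0 \<le> a j \<and> a j \<le> c \<Longrightarrow> \<bar>\<Sum>j=1..N. p k j * a j\<bar> \<le> c"
    and z: "\<And>k. k \<in> {1..K} \<Longrightarrow> z k = 1 \<or> z k = -1"
    and feas: "mle_feasible c L N y a0 \<beta>0 \<gamma>0" and opt: "mle_optimal c L K N y p z a \<beta> \<gamma>"
    and space: "\<And>d. d 1 = 0 \<Longrightarrow> expands_in {1..K} r q (\<lambda>k. \<Sum>j=1..N. p k j * d j)"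
    and S: "(\<Sum>i<r. (sum_prod {1..K} (q i) (\<lambda>k. logit_score (\<Sum>j=1..N. p k j * a0 j) (z k)))\<^sup>2)
      \<le> real R + 2 * sqrt (real R * (- ln \<delta>)) + 2 * (- ln \<delta>)"
  shows "L2_norm N (\<lambda>j. a j - a0 j)
    \<le> (sqrt (sq_radius c K R \<delta>) + sqrt (sq_radius c K R \<delta> + lam * (c * sqrt (real (N - 1)))\<^sup>2))
      / sqrt (min_eigenvalue (Sigma_D K N p + lam \<cdot>\<^sub>m 1\<^sub>m (N - 1)))"
proof -
  let ?m = "\<lambda>a k. \<Sum>j=1..N. p k j * a j"
  let ?V = "\<lambda>k. logit_score (?m a0 k) (z k)"
  let ?\<mu> = "min_eigenvalue (Sigma_D K N p + lam \<cdot>\<^sub>m 1\<^sub>m (N - 1))"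
  define d where "d j = a j - a0 j" for j
  have feas_a: "mle_feasible c L N y a \<beta> \<gamma>" using opt by (simp add: mle_optimal_def)
  note range = mle_feasible_range[OF feas_a y N] mle_feasible_range[OF feas y N]
  have d1: "d 1 = 0" using feas feas_a by (simp add: mle_feasible_def d_def)
  have md: "?m a k - ?m a0 k = ?m d k" for k
    by (simp add: d_def algebra_simps sum_subtractf)
  have "log_likelihood K N p z a0 \<le> log_likelihood K N p z a"
    using opt feas unfolding mle_optimal_def by blast
  then have "omega c / 2 * (\<Sum>k=1..K. (?m a k - ?m a0 k)\<^sup>2) \<le> (\<Sum>k=1..K. ?V k * (?m a k - ?m a0 k))"
    using range by (intro likelihood_increase_bound z p) auto
  then have "omega c / 2 * sum_prod {1..K} (?m d) (?m d) \<le> sum_prod {1..K} ?V (?m d)"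
    unfolding md sum_prod_def by (simp only: power2_eq_square)
  from quadratic_domination_bound[OF space[of d, OF d1] omega_pos this]
  have "sum_prod {1..K} (?m d) (?m d) \<le> 4 * (\<Sum>i<r. (sum_prod {1..K} (q i) ?V)\<^sup>2) / (omega c)\<^sup>2" .
  also have "\<dots> \<le> 4 * (real R + 2 * sqrt (real R * (- ln \<delta>)) + 2 * (- ln \<delta>)) / (omega c)\<^sup>2"
    using S by (intro divide_right_mono mult_left_mono) auto
  also have "\<dots> = 4 * (real K * sq_radius c K R \<delta>)"
    using K by (simp add: sq_radius_def)
  finally have X: "1 / real K * (\<Sum>k=1..K. (?m d k)\<^sup>2) \<le> 4 * sq_radius c K R \<delta>"
    using K by (simp add: sum_prod_def power2_eq_square field_simps)
  \<comment> \<open>Both vectors are 0 at the first grid point, so N - 1 coordinates remain; each is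
    a difference of two numbers in [0, c].\<close>
  have "(\<Sum>j=1..N. (d j)\<^sup>2) = (\<Sum>j=2..N. (d j)\<^sup>2)"
    using d1 N by (subst sum.atLeast_Suc_atMost) (auto simp: numeral_2_eq_2)
  also have "\<dots> \<le> (\<Sum>j=2..N. c\<^sup>2)"
  proof (rule sum_mono)
    fix j assume "j \<in> {2..N}"
    then have "\<bar>d j\<bar> \<le> c" using range[of j] by (auto simp: d_def abs_le_iff)
    then show "(d j)\<^sup>2 \<le> c\<^sup>2" using c by (simp add: abs_le_square_iff[symmetric])
  qed
  also have "\<dots> = (c * sqrt (real (N - 1)))\<^sup>2" by (simp add: power_mult_distrib)
  finally have D: "(\<Sum>j=1..N. (d j)\<^sup>2) \<le> (c * sqrt (real (N - 1)))\<^sup>2" .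
  have "ln \<delta> \<le> 0" using \<delta> by simp
  moreover from this have "sqrt (- real R * ln \<delta>) \<ge> 0" by (simp add: mult_nonneg_nonpos)
  ultimately have "0 \<le> real R + 2 * sqrt (- real R * ln \<delta>) - 2 * ln \<delta>" by linarith
  then have \<rho>: "sq_radius c K R \<delta> \<ge> 0" by (simp add: sq_radius_def)
  have "?\<mu> * (\<Sum>j=1..N. (d j)\<^sup>2) \<le> 4 * sq_radius c K R \<delta> + lam * (c * sqrt (real (N - 1)))\<^sup>2"
    using ridge_min_eigenvalue(2)[where d = d and p = p and K = K, OF N lam d1] X mult_left_mono[OF D, of lam] lam by linarith
  moreover have "(L2_norm N d)\<^sup>2 = (\<Sum>j=1..N. (d j)\<^sup>2)"
    unfolding L2_norm_def L2_set_def by (simp add: sum_nonneg)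
  ultimately have "L2_norm N d \<le> (sqrt (sq_radius c K R \<delta>)
      + sqrt (sq_radius c K R \<delta> + lam * (c * sqrt (real (N - 1)))\<^sup>2)) / sqrt ?\<mu>"
    using \<rho> lam by (intro sqrt_sum_bound ridge_min_eigenvalue(1)[OF N lam]) auto
  then show ?thesis unfolding d_def .
qed

theorem proposition5:
  fixes b L c \<sigma> \<delta> lam :: real
    and K N :: nat
    and W Y :: "nat \<Rightarrow> real pmf"
    and u :: "real \<Rightarrow> real"
    and y :: "nat \<Rightarrow> real"
    and M :: "'a measure"
    and \<epsilon> :: "nat \<Rightarrow> nat \<Rightarrow> 'a \<Rightarrow> real"
    and Z :: "nat \<Rightarrow> 'a \<Rightarrow> real"
    and p :: "nat \<Rightarrow> nat \<Rightarrow> real"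
    and \<Sigma> :: "real mat"
  assumes "b > 0" and "L > 0" and "c > 0" and "K \<ge> 1"
    and lotteries: "\<And>k. k \<in> {1..K} \<Longrightarrow> lottery_on b (W k) \<and> lottery_on b (Y k)"
    and true_utility: "u \<in> concave_utilities b L"
    and true_scale: "\<sigma> \<ge> 1 / c"
    and prob: "prob_space M"
    and noise_indep:
      "prob_space.indep_vars M (\<lambda>_. borel) (\<lambda>(i, k). \<epsilon> i k) ({1, 2} \<times> {1..K})"
    and noise_gumbel:
      "\<And>i k x. i \<in> {1, 2} \<Longrightarrow> k \<in> {1..K} \<Longrightarrow> cdf (distr M borel (\<epsilon> i k)) x = gumbel_cdf \<sigma> x"
    and response:
      "\<And>k x. k \<in> {1..K} \<Longrightarrow> x \<in> space M \<Longrightarrow>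
         Z k x = (if expected_utility u (W k) + \<epsilon> 1 k x \<ge> expected_utility u (Y k) + \<epsilon> 2 k x
                  then 1 else -1)"
    and grid_ordered: "strict_mono_on {1..N} y"
    and grid_points:
      "y ` {1..N} = {0, b} \<union> (\<Union>k\<in>{1..K}. set_pmf (W k)) \<union> (\<Union>k\<in>{1..K}. set_pmf (Y k))"
    and p: "p = prob_diff W Y y"
    and \<Sigma>: "\<Sigma> = Sigma_D K N p"
    and "lam > 0" and "0 < \<delta>" and "\<delta> < 1"
  shows "measure M {x \<in> space M. \<forall>a \<beta> \<gamma>. mle_optimal c L K N y p (\<lambda>k. Z k x) a \<beta> \<gamma> \<longrightarrow>
           Linf_norm N (\<lambda>j. MLE_ratio a \<gamma> j - u (y j) / \<sigma>)
             \<le> L2_norm N (\<lambda>j. MLE_ratio a \<gamma> j - u (y j) / \<sigma>) \<and>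
           L2_norm N (\<lambda>j. MLE_ratio a \<gamma> j - u (y j) / \<sigma>)
             \<le> (sqrt (sq_radius c K (mat_rank \<Sigma>) \<delta>)
                  + sqrt (sq_radius c K (mat_rank \<Sigma>) \<delta> + lam * (c * sqrt (real (N - 1)))\<^sup>2))
               / sqrt (min_eigenvalue (\<Sigma> + lam \<cdot>\<^sub>m 1\<^sub>m (N - 1)))} \<ge> 1 - \<delta>"
proof -
  interpret prob_space M by (rule prob)
  define E where "E = (\<lambda>k. expected_utility u (W k) - expected_utility u (Y k))"
  define a0 where "a0 = (\<lambda>j. u (y j) / \<sigma>)"
  \<comment> \<open>A property of response vectors rather than of sample points, as
    \<open>measurable_finite_valued_event\<close> requires.\<close>
  define Q where "Q = (\<lambda>z. \<forall>a \<beta> \<gamma>. mle_optimal c L K N y p z a \<beta> \<gamma> \<longrightarrow>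
           Linf_norm N (\<lambda>j. MLE_ratio a \<gamma> j - u (y j) / \<sigma>)
             \<le> L2_norm N (\<lambda>j. MLE_ratio a \<gamma> j - u (y j) / \<sigma>) \<and>
           L2_norm N (\<lambda>j. MLE_ratio a \<gamma> j - u (y j) / \<sigma>)
             \<le> (sqrt (sq_radius c K (mat_rank \<Sigma>) \<delta>)
                  + sqrt (sq_radius c K (mat_rank \<Sigma>) \<delta> + lam * (c * sqrt (real (N - 1)))\<^sup>2))
               / sqrt (min_eigenvalue (\<Sigma> + lam \<cdot>\<^sub>m 1\<^sub>m (N - 1))))"
  have \<sigma>: "\<sigma> > 0" using true_scale \<open>c > 0\<close> by (smt (verit) divide_pos_pos)
  have inj: "inj_on y {1..N}" using grid_ordered by (rule strict_mono_on_imp_inj_on)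
  have grid_range: "y ` {1..N} \<subseteq> {0..b}"
  proof -
    have "set_pmf (W k) \<subseteq> {0..b}" "set_pmf (Y k) \<subseteq> {0..b}" if "k \<in> {1..K}" for k
      using lotteries[OF that] by (auto simp: lottery_on_def)
    moreover have "{0, b} \<subseteq> {0..b}" using \<open>b > 0\<close> by auto
    ultimately show ?thesis unfolding grid_points by blast
  qed
  have range: "y j \<in> {0..b}" if "j \<in> {1..N}" for j using grid_range that by blast
  have mono: "y i \<le> y j" if "i \<in> {1..N}" "j \<in> {1..N}" "i \<le> j" for i j
    using strict_mono_on_leD[OF grid_ordered that] .
  have "0 \<in> y ` {1..N}" "b \<in> y ` {1..N}" unfolding grid_points by auto
  then obtain i0 ib where i0: "i0 \<in> {1..N}" "y i0 = 0" and ib: "ib \<in> {1..N}" "y ib = b" by (metis imageE)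
  have "y 1 = 0" using mono[of 1 i0] range[of 1] i0 by force
  moreover have "y N = b" using mono[of ib N] range[of N] ib by force
  ultimately have ends: "y 1 = 0" "y N = b" .
  have N: "N \<ge> 2"
  proof (rule ccontr)
    assume "\<not> N \<ge> 2"
    then have "N = 1" using i0 by auto
    then show False using ends \<open>b > 0\<close> by simp
  qed
  have supp: "set_pmf (W k) \<subseteq> y ` {1..N}" "set_pmf (Y k) \<subseteq> y ` {1..N}" if "k \<in> {1..K}" for k
    unfolding grid_points using that by auto
  have feas0: "mle_feasible c L N y a0 (\<lambda>j. (u (y (j + 1)) / \<sigma> - u (y j) / \<sigma>) / (y (j + 1) - y j)) (1 / \<sigma>)"
    unfolding a0_def
    by (rule scaled_utility_feasible[OF true_utility true_scale \<open>c > 0\<close> N grid_ordered range ends])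
  have p_sum: "(\<Sum>j=1..N. p k j * a j) = (\<Sum>j=1..N. pmf (W k) (y j) * a j) - (\<Sum>j=1..N. pmf (Y k) (y j) * a j)"
    for k a by (simp add: p prob_diff_def left_diff_distrib sum_subtractf)
  have margin: "\<bar>\<Sum>j=1..N. p k j * a j\<bar> \<le> c" if "k \<in> {1..K}" "\<forall>j\<in>{1..N}. 0 \<le> a j \<and> a j \<le> c" for k a
    using pmf_weighted_sum_bounds[OF inj supp(1)[OF that(1)], of a c]
      pmf_weighted_sum_bounds[OF inj supp(2)[OF that(1)], of a c] that(2)
    unfolding p_sum by (simp add: abs_le_iff)
  have true_margin: "(\<Sum>j=1..N. p k j * a0 j) = E k / \<sigma>" if "k \<in> {1..K}" for k
    unfolding p_sum E_def expected_utility_grid[OF inj supp(1)[OF that]] expected_utility_grid[OF inj supp(2)[OF that]]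
    by (simp add: a0_def diff_divide_distrib sum_divide_distrib)
  have Z: "Z k x = (if \<epsilon> 2 k x \<le> \<epsilon> 1 k x + E k then 1 else -1)" if "k \<in> {1..K}" "x \<in> space M" for k x
    using response[OF that] by (simp add: E_def algebra_simps)
  have Z_values: "Z k x = 1 \<or> Z k x = -1" if "k \<in> {1..K}" "x \<in> space M" for k x
    using Z[OF that] by simp
  have Z_meas: "random_variable borel (Z k)" if "k \<in> {1..K}" for k
    by (rule gumbel_response_score_mgf(1)[OF noise_indep _ \<sigma> noise_gumbel Z that]) auto
  define V where "V = (\<lambda>k x. logit_score (E k / \<sigma>) (Z k x))"
  have V_meas: "random_variable borel (V k)" if "k \<in> {1..K}" for k
    unfolding V_def logit_score_def using Z_meas[OF that] by measurable
  have V_mgf: "(\<integral>\<^sup>+x. ennreal (exp (\<Sum>k\<in>{1..K}. w k * V k x)) \<partial>M) \<le> ennreal (exp (sum_prod {1..K} w w / 2))" for w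
    unfolding V_def
    by (rule gumbel_response_score_mgf(2)[OF noise_indep _ \<sigma> noise_gumbel Z]) auto
  \<comment> \<open>The family is fixed before any sample point is considered, so the tail bound
    applies to it.\<close>
  obtain r q where r: "r \<le> mat_rank \<Sigma>" and q: "orthonormal {1..K} r q"
    and space: "\<And>d. d 1 = 0 \<Longrightarrow> expands_in {1..K} r q (\<lambda>k. \<Sum>j=1..N. p k j * d j)"
    using design_column_space[OF N \<open>K \<ge> 1\<close>, of p] unfolding \<Sigma> by blast
  \<comment> \<open>The threshold for t = - ln \<delta>, at which the tail probability exp (- t) is
    \<delta>.\<close>
  define T where "T = real (mat_rank \<Sigma>) + 2 * sqrt (real (mat_rank \<Sigma>) * (- ln \<delta>)) + 2 * (- ln \<delta>)"
  define S where "S = (\<lambda>x. \<Sum>i<r. (sum_prod {1..K} (q i) (\<lambda>k. V k x))\<^sup>2)"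
  have tail: "prob {x \<in> space M. S x > T} \<le> \<delta>"
    using quadratic_form_tail[OF V_meas V_mgf q r, of "- ln \<delta>"] \<open>0 < \<delta>\<close> \<open>\<delta> < 1\<close>
    by (simp add: S_def T_def)
  have S_meas [measurable]: "S \<in> borel_measurable M"
    unfolding S_def sum_prod_def using V_meas by measurable
  have good: "Q (\<lambda>k. Z k x)" if x: "x \<in> space M" "S x \<le> T" for x
    unfolding Q_def MLE_ratio_eq
  proof (intro allI impI conjI)
    fix a \<beta> \<gamma> assume opt: "mle_optimal c L K N y p (\<lambda>k. Z k x) a \<beta> \<gamma>"
    show "Linf_norm N (\<lambda>j. a j - u (y j) / \<sigma>) \<le> L2_norm N (\<lambda>j. a j - u (y j) / \<sigma>)"
      using N by (intro Linf_norm_le_L2_norm) simp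
    have "sum_prod {1..K} v (\<lambda>k. logit_score (\<Sum>j=1..N. p k j * a0 j) (Z k x)) = sum_prod {1..K} v (\<lambda>k. V k x)" for v
      by (intro sum_prod_cong refl) (simp only: V_def true_margin)
    then have "(\<Sum>i<r. (sum_prod {1..K} (q i) (\<lambda>k. logit_score (\<Sum>j=1..N. p k j * a0 j) (Z k x)))\<^sup>2) \<le> T"
      using x(2) by (simp add: S_def)
    then have "L2_norm N (\<lambda>j. a j - a0 j)
      \<le> (sqrt (sq_radius c K (mat_rank \<Sigma>) \<delta>) + sqrt (sq_radius c K (mat_rank \<Sigma>) \<delta> + lam * (c * sqrt (real (N - 1)))\<^sup>2))
        / sqrt (min_eigenvalue (Sigma_D K N p + lam \<cdot>\<^sub>m 1\<^sub>m (N - 1)))"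
      unfolding T_def
      by (intro mle_error_bound[OF \<open>c > 0\<close> \<open>K \<ge> 1\<close> N \<open>lam > 0\<close> \<open>0 < \<delta>\<close> \<open>\<delta> < 1\<close> grid_ordered
            margin Z_values[OF _ x(1)] feas0 opt space])
    then show "L2_norm N (\<lambda>j. a j - u (y j) / \<sigma>)
      \<le> (sqrt (sq_radius c K (mat_rank \<Sigma>) \<delta>) + sqrt (sq_radius c K (mat_rank \<Sigma>) \<delta> + lam * (c * sqrt (real (N - 1)))\<^sup>2))
        / sqrt (min_eigenvalue (\<Sigma> + lam \<cdot>\<^sub>m 1\<^sub>m (N - 1)))"
      unfolding a0_def \<Sigma> .
  qed
  \<comment> \<open>The event in the claim contains the event \<open>S x \<le> T\<close>; comparing
    their measures requires the larger one to be measurable.\<close>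
  have Q_meas: "{x \<in> space M. Q (\<lambda>k. Z k x)} \<in> sets M"
  proof (rule measurable_finite_valued_event[of "{1..K}" Z M "{1, -1}"])
    fix z z' :: "nat \<Rightarrow> real" assume "\<And>k. k \<in> {1..K} \<Longrightarrow> z k = z' k" and "Q z"
    then show "Q z'" unfolding Q_def using mle_optimal_cong[of K z z'] by blast
  qed (use Z_meas Z_values in auto)
  have "1 - \<delta> \<le> 1 - prob {x \<in> space M. S x > T}" using tail by simp
  also have "\<dots> = prob (space M - {x \<in> space M. S x > T})"
    by (rule prob_compl[symmetric]) measurable
  also have "\<dots> \<le> prob {x \<in> space M. Q (\<lambda>k. Z k x)}"
    using good by (intro finite_measure_mono[OF _ Q_meas]) (auto simp: not_less)
  finally show ?thesis unfolding Q_def .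
qed

end
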